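(* For every rooted plane tree $\mathsf{T}$, the poset $\mathrm{MN}(\mathsf{T})$ of maximal nestings of $\mathsf{T}$ is a lattice.
   Context: A rooted plane tree is a rooted tree in which the children of each vertex are linearly ordered from left to right. Let $\mathsf{T}$ be a rooted plane tree with $n+1$ vertices and vertex set $\mathsf{V}$. View $\mathsf{V}$ as a poset $(\mathsf{V},\leq_\mathsf{T})$ in which the root is the unique minimal element and every non-root vertex covers exactly its parent (so $v\leq_\mathsf{T} w$ iff $v$ lies on the path from the root to $w$). Identify $\mathsf{V}$ with $\{0,1,\ldots,n\}$ so that $0,1,\ldots,n$ is the preorder traversal of $\mathsf{T}$ (read the root first, then the subtrees of the root, each recursively in preorder, from left to right). A tube of $\mathsf{T}$ is a set of vertices inducing a connected subgraph of $\mathsf{T}$; its root is its unique $\leq_\mathsf{T}$-minimal element. A nesting of $\mathsf{T}$ is a collection $\mathcal N$ of tubes such that $\mathsf{V}\in\mathcal N$, every tube in $\mathcal N$ has at least $2$ elements, and any two tubes in $\mathcal N$ are nested (one contains the other) or disjoint. A maximal nesting is a nesting with exactly $n$ tubes; $\mathrm{MN}(\mathsf{T})$ is the set of maximal nestings. Two maximal nestings $\mathcal N,\mathcal N'$ are adjacent if there exist $\tau\in\mathcal N\setminus\mathcal N'$ and $\tau'\in\mathcal N'\setminus\mathcal N$ with $\mathcal N\setminus\{\tau\}=\mathcal N'\setminus\{\tau'\}$ (equivalently, they correspond to adjacent vertices of the operahedron of $\mathsf{T}$, a polytope whose face lattice is dual to the poset of nestings with a top element adjoined). For such adjacent $\mathcal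 N,\mathcal N'$, some element of $\tau\setminus\tau'$ is less than some element of $\tau'\setminus\tau$ in $\mathbb Z$ if and only if every element of $\tau\setminus\tau'$ is less than every element of $\tau'\setminus\tau$; when this holds we declare $\mathcal N\lessdot\mathcal N'$. The partial order on $\mathrm{MN}(\mathsf{T})$ is the reflexive–transitive closure of these relations (which are its cover relations).
   Formalization: The stated "some iff every" equivalence fails (tree edges 0-1, 1-2, 0-3; differences {0,3} and {2}), so the order is ill-defined; here N⋖N' means some element of τ∖τ' is less than every element of τ'∖τ, i.e. the minima are compared. *)

theory Defs
  imports Main "HOL-Algebra.Lattice"
begin

datatype 'a plane_tree = Node (root_vertex: 'a) (children: "'a plane_tree list")

primrec preorder_traversal :: "'a plane_tree \<Rightarrow> 'a list" where
  "preorder_traversal (Node v ts) = v # concat (map preorder_traversal ts)"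

definition vertices :: "'a plane_tree \<Rightarrow> 'a set" where
  "vertices T = set (preorder_traversal T)"

(* Pairs (parent, child). *)
primrec edges :: "'a plane_tree \<Rightarrow> ('a \<times> 'a) set" where
  "edges (Node v ts) = (\<lambda>t. (v, root_vertex t)) ` set ts \<union> \<Union> (set (map edges ts))"

(* Reachability inside the subgraph induced on S, edges taken as undirected. *)
definition induces_connected :: "'a plane_tree \<Rightarrow> 'a set \<Rightarrow> bool" where
  "induces_connected T S \<longleftrightarrow>
     S \<noteq> {} \<and> (\<forall>u\<in>S. \<forall>w\<in>S. (u, w) \<in> ((edges T \<union> (edges T)\<inverse>) \<inter> S \<times> S)\<^sup>*)"

definition tube :: "'a plane_tree \<Rightarrow> 'a set \<Rightarrow> bool" where
  "tube T S \<longleftrightarrow> S \<subseteq> vertices T \<and> induces_connected T S"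

definition nesting :: "'a plane_tree \<Rightarrow> 'a set set \<Rightarrow> bool" where
  "nesting T N \<longleftrightarrow>
     vertices T \<in> N \<and>
     (\<forall>S\<in>N. tube T S \<and> card S \<ge> 2) \<and>
     (\<forall>S\<in>N. \<forall>S'\<in>N. S \<subseteq> S' \<or> S' \<subseteq> S \<or> S \<inter> S' = {})"

(* A tree with n + 1 vertices: a maximal nesting has n tubes. *)
definition maximal_nestings :: "'a plane_tree \<Rightarrow> 'a set set set" where
  "maximal_nestings T = {N. nesting T N \<and> card N + 1 = card (vertices T)}"

(* The tubes exchanged between adjacent maximal nestings are determined by the nestings.
   They are compared through the least elements of \<tau> - \<tau>' and \<tau>' - \<tau>, i.e. some element of
   \<tau> - \<tau>' must lie below all of \<tau>' - \<tau>.  Asking only for some pair a < b, or asking for all pairs,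
   gives the same relation as long as one of the differences lies entirely below the other, but
   this can fail: for the tree with edges 0-1, 1-2, 0-3, the adjacent maximal nestings
   {V, {0,3}, {0,1,3}} and {V, {0,3}, {1,2}} have differences {0,3} and {2}.  There, asking for some
   pair relates the two nestings in both directions, and asking for all pairs in neither. *)
definition nesting_cover :: "nat plane_tree \<Rightarrow> nat set set \<Rightarrow> nat set set \<Rightarrow> bool" where
  "nesting_cover T N N' \<longleftrightarrow>
     N \<in> maximal_nestings T \<and> N' \<in> maximal_nestings T \<and>
     (\<exists>\<tau>\<in>N - N'. \<exists>\<tau>'\<in>N' - N.
        N - {\<tau>} = N' - {\<tau>'} \<and> (\<exists>a\<in>\<tau> - \<tau>'. \<forall>b\<in>\<tau>' - \<tau>. a < b))"

definition MN :: "nat plane_tree \<Rightarrow> nat set set gorder" where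
  "MN T = \<lparr>carrier = maximal_nestings T, eq = (=), le = (nesting_cover T)\<^sup>*\<^sup>*\<rparr>"

end

theory Submission imports Defs begin

text \<open>Name each edge after its lower end. In a maximal nesting, every tube is the smallest tube
  around precisely one edge, so nestings become partial orders on edges: \<open>a\<close> lies below \<open>b\<close> if the
  edge \<open>a\<close> belongs to the tube of \<open>b\<close>. Going up in the poset, the set of pairs \<open>a < b\<close> with \<open>a\<close> below
  \<open>b\<close> shrinks, and the poset turns out to be isomorphic to these sets under reverse inclusion. With
  this description, an element \<open>M\<close> above \<open>N\<close> lies above the upward flip of \<open>N\<close> at \<open>f < e\<close> as soon
  as \<open>f\<close> is not below \<open>e\<close> in \<open>M\<close>. This makes it easy to find the join of two upper covers of a common
  element, which suffices by the criterion of Bjorner, Edelman and Ziegler.\<close>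

section \<open>Trees numbered in preorder\<close>

text \<open>The tree enters only through its parent function on \<open>{0..n}\<close>. Numbering in
  preorder amounts to \<open>par v < v\<close> together with arcs from \<open>par v\<close> to
  \<open>v\<close> that do not cross; this makes the descendants of a vertex an interval starting at
  that vertex. Two facts about a maximal nesting then carry the combinatorics. Tubes are connected,
  so whatever lies below \<open>b\<close> brings along all edges on its path to \<open>b\<close>
  (\<open>rel_sep\<close>). And the smallest tube around two edges belongs to an edge of the path
  joining them (\<open>path_max\<close>). The obstacle is that the orders \<open>rel N\<close> are
  forests and need not be chains: if \<open>a < b\<close> and \<open>a\<close> is not below
  \<open>b\<close>, then \<open>b\<close> need not be below \<open>a\<close> either. Arguments known
  for inversion sets of permutations therefore do not transfer directly, and \<open>path_max\<close>
  supplies an edge above both \<open>a\<close> and \<open>b\<close> to work with instead. An upward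
  flip cuts the tube of \<open>e\<close> at \<open>f < e\<close>, which loses pairs, but it also
  enlarges the tube of \<open>f\<close>. No pair is gained because the edges added there are
  \<open>e\<close> or descendants of \<open>e\<close>, hence larger than \<open>f\<close>.\<close>

locale preorder_parents =
  fixes n :: nat and par :: "nat \<Rightarrow> nat"
  assumes par_less: "0 < v \<Longrightarrow> v \<le> n \<Longrightarrow> par v < v"
    and noncrossing: "v \<le> n \<Longrightarrow> par v < u \<Longrightarrow> u < v \<Longrightarrow> par v \<le> par u"
begin

text \<open>The descendants of \<open>m\<close>, including \<open>m\<close>. In preorder they form
  an interval that stops before the first later vertex whose parent is smaller than
  \<open>m\<close>, so no iteration of \<open>par\<close> is needed.\<close>

definition desc :: "nat \<Rightarrow> nat set" where
  "desc m = {v. m \<le> v \<and> v \<le> n \<and> (\<forall>u. m < u \<and> u \<le> v \<longrightarrow> m \<le> par u)}"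

lemma desc_self: "m \<le> n \<Longrightarrow> m \<in> desc m"
  by (simp add: desc_def)

lemma desc_ge: "v \<in> desc m \<Longrightarrow> m \<le> v"
  by (simp add: desc_def)

lemma desc_convex: "w \<in> desc m \<Longrightarrow> m \<le> v \<Longrightarrow> v \<le> w \<Longrightarrow> v \<in> desc m"
  by (auto simp: desc_def)

text \<open>The edge \<open>m\<close> is thus the only one that can join \<open>desc m\<close> to
  its complement. For the forward direction, vertices up to \<open>par v\<close> are covered by the
  assumption, and those between \<open>par v\<close> and \<open>v\<close> by
  \<open>noncrossing\<close>.\<close>

lemma par_in_desc_iff:
  assumes "0 < v" "v \<le> n" "v \<noteq> m"
  shows "par v \<in> desc m \<longleftrightarrow> v \<in> desc m"
proof
  assume p: "par v \<in> desc m"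
  have "m \<le> par u" if "m < u" "u \<le> v" for u
  proof (cases "u \<le> par v")
    case True
    then show ?thesis using p that by (auto simp: desc_def)
  next
    case False
    then have "par v \<le> par u"
      using noncrossing[of v u] that assms by (cases "u = v") auto
    then show ?thesis using p by (auto simp: desc_def)
  qed
  then show "v \<in> desc m"
    using p par_less[OF assms(1,2)] assms by (auto simp: desc_def)
next
  assume v: "v \<in> desc m"
  then have "m \<le> par v" using assms by (auto simp: desc_def)
  then show "par v \<in> desc m"
    using desc_convex[OF v] par_less[OF assms(1,2)] by simp
qed

lemma par_notin_desc: "0 < m \<Longrightarrow> m \<le> n \<Longrightarrow> par m \<notin> desc m"
  using par_less[of m] desc_ge[of "par m" m] by linarith

definition subtree :: "nat set \<Rightarrow> bool" where
  "subtree S \<longleftrightarrow> S \<subseteq> {..n} \<and> (\<exists>r\<in>S. \<forall>v\<in>S. v \<noteq> r \<longrightarrow> r < v \<and> par v \<in> S)"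

text \<open>The edge joining \<open>v > 0\<close> to its parent is named after its lower end \<open>v\<close>, so
  \<open>inner S\<close> is the set of edges of the subgraph induced on \<open>S\<close>.\<close>

definition inner :: "nat set \<Rightarrow> nat set" where
  "inner S = {v \<in> S. 0 < v \<and> par v \<in> S}"

lemma innerD: "v \<in> inner S \<Longrightarrow> 0 < v" "v \<in> inner S \<Longrightarrow> v \<in> S" "v \<in> inner S \<Longrightarrow> par v \<in> S"
  by (auto simp: inner_def)

lemma inner_mono: "S \<subseteq> S' \<Longrightarrow> inner S \<subseteq> inner S'"
  by (auto simp: inner_def)

lemma subtree_le: "subtree S \<Longrightarrow> v \<in> S \<Longrightarrow> v \<le> n"
  by (auto simp: subtree_def)

lemma subtree_finite: "subtree S \<Longrightarrow> finite S"
  by (auto simp: subtree_def intro: finite_subset)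

lemma subtree_root:
  assumes "subtree S"
  obtains r where "r \<in> S" "\<And>v. v \<in> S \<Longrightarrow> v \<noteq> r \<Longrightarrow> v \<in> inner S \<and> r < v"
proof -
  obtain r where "r \<in> S" "\<forall>v\<in>S. v \<noteq> r \<longrightarrow> r < v \<and> par v \<in> S"
    using assms unfolding subtree_def by blast
  then show ?thesis by (intro that[of r]) (auto simp: inner_def)
qed

text \<open>If the root of \<open>S\<close> were in \<open>desc m\<close>, all of \<open>S\<close>
  would be. So the root is outside, and climbing from \<open>u\<close> towards it has to use the
  edge \<open>m\<close>.\<close>

lemma subtree_separates:
  assumes "subtree S" "u \<in> S" "u \<in> desc m" "w \<in> S" "w \<notin> desc m"
  shows "m \<in> inner S"
proof -
  obtain r where r: "r \<in> S" "\<And>v. v \<in> S \<Longrightarrow> v \<noteq> r \<Longrightarrow> v \<in> inner S \<and> r < v"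
    using subtree_root[OF assms(1)] by blast
  have le: "\<And>v. v \<in> S \<Longrightarrow> v \<le> n" using subtree_le[OF assms(1)] .
  have rn: "r \<notin> desc m"
  proof
    assume rm: "r \<in> desc m"
    have "v \<in> desc m" if "v \<in> S" for v
      using that
    proof (induction v rule: less_induct)
      case (less v)
      show ?case
      proof (cases "v = r")
        case False
        then have v: "v \<in> inner S" "r < v" using r(2) less.prems by auto
        then have "par v \<in> desc m"
          using less.IH innerD[OF v(1)] par_less le less.prems by blast
        moreover have "v \<noteq> m" using v(2) desc_ge[OF rm] by simp
        ultimately show ?thesis using par_in_desc_iff innerD[OF v(1)] le less.prems by blast
      qed (use rm in simp)
    qed
    then show False using assms by blast
  qed
  have "m \<in> inner S" if "v \<in> S" "v \<in> desc m" for v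
    using that
  proof (induction v rule: less_induct)
    case (less v)
    then have v: "v \<in> inner S" using r(2) rn by metis
    show ?case
    proof (cases "v = m")
      case False
      then have "par v \<in> desc m"
        using par_in_desc_iff innerD[OF v] le less.prems by blast
      then show ?thesis using less.IH innerD[OF v] par_less le less.prems by blast
    qed (use v in simp)
  qed
  then show ?thesis using assms by blast
qed

text \<open>Otherwise membership in \<open>Q\<close> would be constant along parent links, hence
  equal to that of the root on all of \<open>K\<close>.\<close>

lemma subtree_crossing:
  assumes "subtree K" "K \<inter> Q \<noteq> {}" "\<not> K \<subseteq> Q"
  obtains x where "x \<in> inner K" "(x \<in> Q) \<noteq> (par x \<in> Q)"
proof (rule ccontr)
  assume "\<not> thesis"
  then have no: "\<And>x. x \<in> inner K \<Longrightarrow> x \<in> Q \<longleftrightarrow> par x \<in> Q" using that by blast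
  obtain r where r: "r \<in> K" "\<And>v. v \<in> K \<Longrightarrow> v \<noteq> r \<Longrightarrow> v \<in> inner K \<and> r < v"
    using subtree_root[OF assms(1)] by blast
  have "v \<in> Q \<longleftrightarrow> r \<in> Q" if "v \<in> K" for v
    using that
  proof (induction v rule: less_induct)
    case (less v)
    show ?case
    proof (cases "v = r")
      case False
      then have v: "v \<in> inner K" using r(2) less.prems by auto
      then have "par v < v" using par_less innerD[OF v] subtree_le[OF assms(1)] by blast
      then show ?thesis using less.IH[of "par v"] no[OF v] innerD[OF v] by blast
    qed simp
  qed
  then show False using assms by blast
qed

lemma inner_nonempty: "subtree S \<Longrightarrow> 2 \<le> card S \<Longrightarrow> inner S \<noteq> {}"
proof -
  assume S: "subtree S" "2 \<le> card S"
  obtain r where r: "r \<in> S" "\<And>v. v \<in> S \<Longrightarrow> v \<noteq> r \<Longrightarrow> v \<in> inner S \<and> r < v"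
    using subtree_root[OF S(1)] by blast
  have "\<not> S \<subseteq> {r}" using S(2) card_mono[of "{r}" S] by auto
  then show ?thesis using r by blast
qed

lemma card_inner:
  assumes "subtree S" "v \<in> inner S"
  shows "2 \<le> card S"
proof -
  have "par v < v"
    using assms par_less innerD subtree_le by blast
  moreover have "{v, par v} \<subseteq> S"
    using innerD[OF assms(2)] by simp
  ultimately show ?thesis
    using card_mono[OF subtree_finite[OF assms(1)], of "{v, par v}"] by simp
qed

lemma subtree_eqI:
  assumes "subtree S" "2 \<le> card S" "subtree S'" "2 \<le> card S'" "inner S = inner S'"
  shows "S = S'"
proof -
  have *: "A \<subseteq> B" if A: "subtree A" "2 \<le> card A" and AB: "inner A = inner B" for A B
  proof
    fix v assume v: "v \<in> A"
    obtain r where r: "r \<in> A" "\<And>v. v \<in> A \<Longrightarrow> v \<noteq> r \<Longrightarrow> v \<in> inner A \<and> r < v"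
      using subtree_root[OF A(1)] by blast
    show "v \<in> B"
    proof (cases "v = r")
      case False
      then show ?thesis using r(2)[OF v] AB innerD by blast
    next
      case True
      \<comment> \<open>The root is not an edge of \<open>A\<close>, so it is recovered as the
        parent of the least edge.\<close>
      define w where "w = (LEAST w. w \<in> inner A)"
      obtain w0 where w0: "w0 \<in> inner A" using inner_nonempty[OF A] by blast
      have w: "w \<in> inner A" unfolding w_def using w0 by (rule LeastI)
      have "par w \<notin> inner A"
        using not_less_Least[of "par w" "\<lambda>w. w \<in> inner A"] par_less[of w] subtree_le[OF A(1)] innerD[OF w]
        unfolding w_def by blast
      then have "par w = r" using r(2)[of "par w"] innerD[OF w] by blast
      then show ?thesis using w AB True innerD by blast
    qed
  qed
  show ?thesis using *[of S S'] *[of S' S] assms by auto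
qed

text \<open>The component of \<open>S\<close> containing \<open>x\<close> after the edge \<open>m\<close> is deleted.\<close>

definition comp :: "nat set \<Rightarrow> nat \<Rightarrow> nat \<Rightarrow> nat set" where
  "comp S m x = (if x \<in> desc m then S \<inter> desc m else S - desc m)"

lemma comp_subset: "comp S m x \<subseteq> S"
  by (auto simp: comp_def)

lemma in_comp: "v \<in> comp S m x \<longleftrightarrow> v \<in> S \<and> (v \<in> desc m \<longleftrightarrow> x \<in> desc m)"
  by (auto simp: comp_def)

lemma subtree_comp:
  assumes "subtree S" "m \<in> inner S"
  shows "subtree (comp S m x)"
proof -
  have le: "\<And>v. v \<in> S \<Longrightarrow> v \<le> n" using subtree_le[OF assms(1)] .
  note m = innerD[OF assms(2)]
  have pm: "par m < m" using par_less m le by blast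
  obtain r where r: "r \<in> S" "\<And>v. v \<in> S \<Longrightarrow> v \<noteq> r \<Longrightarrow> v \<in> inner S \<and> r < v"
    using subtree_root[OF assms(1)] by blast
  show ?thesis
  proof (cases "x \<in> desc m")
    case True
    have "par v \<in> desc m \<and> par v \<in> S \<and> m < v" if v: "v \<in> S" "v \<in> desc m" "v \<noteq> m" for v
    proof -
      have "m < v" using desc_ge[OF v(2)] v(3) by simp
      moreover have "r \<le> m" using r(2) m by (metis less_or_eq_imp_le)
      ultimately have "v \<in> inner S" using r(2) v by auto
      then show ?thesis using \<open>m < v\<close> par_in_desc_iff v innerD le by blast
    qed
    then show ?thesis
      using True m le desc_self[of m] unfolding subtree_def comp_def
      by (auto intro!: bexI[of _ m])
  next
    case False
    have "r \<le> par m" using r(2) m by (metis less_or_eq_imp_le)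
    then have rn: "r \<notin> desc m" using pm desc_ge by fastforce
    have "par v \<notin> desc m \<and> par v \<in> S \<and> r < v" if v: "v \<in> S" "v \<notin> desc m" "v \<noteq> r" for v
    proof -
      have "v \<in> inner S" "r < v" using r(2) v by auto
      moreover have "v \<noteq> m" using v(2) desc_self m le by blast
      ultimately show ?thesis using par_in_desc_iff v innerD le by blast
    qed
    then show ?thesis
      using False r(1) rn le unfolding subtree_def comp_def
      by (auto intro!: bexI[of _ r])
  qed
qed

lemma inner_comp:
  assumes "S \<subseteq> {..n}" "m \<in> inner S"
  shows "y \<in> inner (comp S m x) \<longleftrightarrow> y \<in> inner S \<and> y \<noteq> m \<and> (y \<in> desc m \<longleftrightarrow> x \<in> desc m)"
proof -
  have "m \<le> n" "0 < m" using assms innerD(1,2)[OF assms(2)] by auto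
  then have "par m \<notin> desc m" "m \<in> desc m" using par_notin_desc desc_self by auto
  moreover have "par y \<in> desc m \<longleftrightarrow> y \<in> desc m" if "y \<noteq> m" "y \<in> inner S"
    using par_in_desc_iff[of y m] that assms innerD[OF that(2)] by auto
  ultimately show ?thesis by (auto simp: inner_def in_comp)
qed

section \<open>Maximal nestings as orders on edges\<close>

lemma inner_whole: "inner {..n} = {1..n}"
proof -
  have "par v \<le> n" if "0 < v" "v \<le> n" for v
    using par_less[OF that] that(2) by simp
  then show ?thesis by (auto simp: inner_def)
qed

text \<open>The maximal nestings with connectivity replaced by \<open>subtree\<close>; the number
  \<open>n\<close> of tubes is also the number of edges.\<close>

definition mnest :: "nat set set set" where
  "mnest = {N. {..n} \<in> N \<and> (\<forall>S\<in>N. subtree S \<and> 2 \<le> card S) \<and>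
     (\<forall>S\<in>N. \<forall>S'\<in>N. S \<subseteq> S' \<or> S' \<subseteq> S \<or> S \<inter> S' = {}) \<and> card N = n}"

lemma mnest_whole: "N \<in> mnest \<Longrightarrow> {..n} \<in> N"
  by (simp add: mnest_def)

lemma mnest_subtree: "N \<in> mnest \<Longrightarrow> S \<in> N \<Longrightarrow> subtree S"
  by (simp add: mnest_def)

lemma mnest_card_ge: "N \<in> mnest \<Longrightarrow> S \<in> N \<Longrightarrow> 2 \<le> card S"
  by (simp add: mnest_def)

lemma mnest_laminar:
  "N \<in> mnest \<Longrightarrow> S \<in> N \<Longrightarrow> S' \<in> N \<Longrightarrow> S \<subseteq> S' \<or> S' \<subseteq> S \<or> S \<inter> S' = {}"
  by (simp add: mnest_def)

lemma mnest_card: "N \<in> mnest \<Longrightarrow> card N = n"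
  by (simp add: mnest_def)

lemma mnest_subset: "N \<in> mnest \<Longrightarrow> N \<subseteq> Pow {..n}"
  using mnest_subtree subtree_le by blast

lemma finite_mnest: "finite mnest"
proof (rule finite_subset)
  show "mnest \<subseteq> Pow (Pow {..n})" using mnest_subset by blast
qed simp

lemma mnest_finite: "N \<in> mnest \<Longrightarrow> finite N"
  using mnest_subset finite_subset by blast

lemma mnest_inner: "N \<in> mnest \<Longrightarrow> S \<in> N \<Longrightarrow> inner S \<subseteq> {1..n}"
  using mnest_subset inner_mono[of S "{..n}"] inner_whole by blast

text \<open>A maximal nesting has as many tubes as there are edges; \<open>own N\<close> turns out to be a
  bijection from edges to tubes.\<close>

definition own :: "nat set set \<Rightarrow> nat \<Rightarrow> nat set" where
  "own N b = \<Inter>{S \<in> N. b \<in> inner S}"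

lemma own_least: "S \<in> N \<Longrightarrow> b \<in> inner S \<Longrightarrow> own N b \<subseteq> S"
  by (auto simp: own_def)

lemma own_inner: "b \<in> {1..n} \<Longrightarrow> b \<in> inner (own N b)"
  by (auto simp: own_def inner_def)

lemma own_in:
  assumes "N \<in> mnest" "b \<in> {1..n}"
  shows "own N b \<in> N"
proof -
  let ?C = "{S \<in> N. b \<in> inner S}"
  have "finite ?C" using mnest_finite[OF assms(1)] by simp
  moreover have "{..n} \<in> ?C" using mnest_whole[OF assms(1)] inner_whole assms(2) by blast
  ultimately obtain m where m: "m \<in> ?C" "\<And>S. S \<in> ?C \<Longrightarrow> S \<subseteq> m \<Longrightarrow> m = S"
    using finite_has_minimal[of ?C] by blast
  have "m \<subseteq> S" if "S \<in> ?C" for S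
    using mnest_laminar[OF assms(1), of S m] m that innerD(2) by blast
  then have "own N b = m" using m(1) unfolding own_def by blast
  then show ?thesis using m(1) by simp
qed

text \<open>Take a maximal tube \<open>Q\<close> around \<open>x\<close> among those properly inside
  \<open>S\<close>. If \<open>K\<close> left \<open>Q\<close>, some edge \<open>y\<close> of
  \<open>K\<close> would cross the boundary of \<open>Q\<close>; its tube, also proper in
  \<open>S\<close>, would by laminarity contain \<open>Q\<close> strictly.\<close>

lemma subset_proper_tube:
  assumes N: "N \<in> mnest" "S \<in> N" and K: "subtree K" "K \<subseteq> S" "x \<in> inner K"
    and own: "\<And>y. y \<in> inner K \<Longrightarrow> own N y \<noteq> S"
  shows "\<exists>Q\<in>N. K \<subseteq> Q \<and> Q \<subset> S"
proof -
  let ?C = "{Q \<in> N. Q \<subset> S \<and> x \<in> inner Q}"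
  have range: "inner K \<subseteq> {1..n}" using inner_mono[OF K(2)] mnest_inner[OF N] by blast
  have own_sub: "own N y \<subset> S" if "y \<in> inner K" for y
    using own[OF that] own_least[OF N(2), of y] inner_mono[OF K(2)] that by blast
  have "x \<in> {1..n}" using range K(3) by blast
  then have "own N x \<in> ?C" using own_in[OF N(1)] own_sub[OF K(3)] own_inner by simp
  then have "?C \<noteq> {}" by blast
  moreover have "finite ?C" using mnest_finite[OF N(1)] by simp
  ultimately have "\<exists>Q\<in>?C. \<forall>R\<in>?C. Q \<subseteq> R \<longrightarrow> Q = R"
    by (intro finite_has_maximal)
  then obtain Q where Q: "Q \<in> ?C" "\<forall>R\<in>?C. Q \<subseteq> R \<longrightarrow> Q = R" ..
  have "K \<subseteq> Q"
  proof (rule ccontr)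
    assume "\<not> K \<subseteq> Q"
    moreover have "K \<inter> Q \<noteq> {}" using Q(1) innerD(2)[OF K(3)] innerD(2)[of x Q] by blast
    ultimately obtain y where y: "y \<in> inner K" "(y \<in> Q) \<noteq> (par y \<in> Q)"
      using subtree_crossing[OF K(1)] by blast
    have o: "own N y \<in> N" "y \<in> inner (own N y)" "own N y \<subset> S"
      using own_in[OF N(1), of y] own_inner[of y] own_sub[OF y(1)] range y(1) by blast+
    have not_sub: "\<not> own N y \<subseteq> Q" using y(2) innerD[OF o(2)] by blast
    moreover have "own N y \<inter> Q \<noteq> {}" using y(2) innerD[OF o(2)] by blast
    ultimately have sub: "Q \<subseteq> own N y" using mnest_laminar[OF N(1) o(1), of Q] Q(1) by blast
    then have "own N y \<in> ?C" using o Q(1) inner_mono[OF sub] by blast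
    then have "Q = own N y" using Q(2) sub by blast
    then show False using not_sub by simp
  qed
  then show ?thesis using Q(1) by blast
qed

text \<open>Otherwise \<open>K = S\<close> in \<open>subset_proper_tube\<close> would put
  \<open>S\<close> inside a proper subset of itself.\<close>

lemma own_surj:
  assumes "N \<in> mnest" "S \<in> N"
  obtains b where "b \<in> {1..n}" "own N b = S"
proof -
  have S: "subtree S" using mnest_subtree assms by blast
  obtain x where "x \<in> inner S"
    using inner_nonempty[OF S mnest_card_ge[OF assms]] by blast
  then have "\<exists>y\<in>inner S. own N y = S"
    using subset_proper_tube[OF assms S order_refl] by blast
  then show ?thesis using that mnest_inner[OF assms] by blast
qed

lemma own_image: "N \<in> mnest \<Longrightarrow> own N ` {1..n} = N"
  using own_in own_surj by blast

lemma own_inj: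
  assumes "N \<in> mnest" "a \<in> {1..n}" "b \<in> {1..n}"
  shows "own N a = own N b \<longleftrightarrow> a = b"
proof -
  have "inj_on (own N) {1..n}"
    using own_image[OF assms(1)] mnest_card[OF assms(1)] by (intro eq_card_imp_inj_on) auto
  then show ?thesis using assms(2,3) by (rule inj_on_eq_iff)
qed

definition rel :: "nat set set \<Rightarrow> nat \<Rightarrow> nat \<Rightarrow> bool" where
  "rel N a b \<longleftrightarrow> a \<in> inner (own N b)"

lemma rel_range: "N \<in> mnest \<Longrightarrow> b \<in> {1..n} \<Longrightarrow> rel N a b \<Longrightarrow> a \<in> {1..n}"
  using own_in mnest_inner unfolding rel_def by blast

lemma rel_refl: "a \<in> {1..n} \<Longrightarrow> rel N a a"
  by (simp add: rel_def own_inner)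

lemma rel_iff:
  assumes "N \<in> mnest" "a \<in> {1..n}" "b \<in> {1..n}"
  shows "rel N a b \<longleftrightarrow> own N a \<subseteq> own N b"
proof
  assume "rel N a b"
  then show "own N a \<subseteq> own N b"
    using own_least[OF own_in[OF assms(1,3)]] by (simp add: rel_def)
next
  assume "own N a \<subseteq> own N b"
  then have "inner (own N a) \<subseteq> inner (own N b)" by (rule inner_mono)
  then show "rel N a b"
    using own_inner[OF assms(2), of N] unfolding rel_def by (rule subsetD)
qed

lemma rel_trans:
  assumes "N \<in> mnest" "c \<in> {1..n}" "rel N a b" "rel N b c"
  shows "rel N a c"
proof -
  have b: "b \<in> {1..n}" using rel_range[OF assms(1,2,4)] .
  have a: "a \<in> {1..n}" using rel_range[OF assms(1) b assms(3)] .
  show ?thesis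
    using assms(3,4) rel_iff[OF assms(1) a b] rel_iff[OF assms(1) b assms(2)]
      rel_iff[OF assms(1) a assms(2)] by simp
qed

lemma rel_antisym:
  assumes "N \<in> mnest" "b \<in> {1..n}" "rel N a b" "rel N b a"
  shows "a = b"
proof -
  have a: "a \<in> {1..n}" using rel_range[OF assms(1-3)] .
  have "own N a = own N b"
    using iffD1[OF rel_iff[OF assms(1) a assms(2)] assms(3)]
      iffD1[OF rel_iff[OF assms(1,2) a] assms(4)] by (rule subset_antisym)
  then show ?thesis using own_inj[OF assms(1) a assms(2)] by (rule iffD1[rotated])
qed

text \<open>The common edge \<open>c\<close> makes the two tubes meet, so laminarity applies: the
  edges above \<open>c\<close> form a chain.\<close>

lemma rel_forest:
  assumes "N \<in> mnest" "a \<in> {1..n}" "b \<in> {1..n}" "rel N c a" "rel N c b"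
  shows "rel N a b \<or> rel N b a"
proof -
  have "own N a \<inter> own N b \<noteq> {}" using assms(4,5) unfolding rel_def inner_def by blast
  then show ?thesis
    using mnest_laminar[OF assms(1) own_in[OF assms(1,2)] own_in[OF assms(1,3)]]
      rel_iff[OF assms(1-3)] rel_iff[OF assms(1,3,2)] by simp
qed

text \<open>If \<open>m\<close> is neither \<open>a\<close> nor \<open>b\<close>, then \<open>sep m a b\<close> says that the edge \<open>m\<close> lies on the
  path between the edges \<open>a\<close> and \<open>b\<close>.\<close>

definition sep :: "nat \<Rightarrow> nat \<Rightarrow> nat \<Rightarrow> bool" where
  "sep m a b \<longleftrightarrow> (a \<in> desc m) \<noteq> (b \<in> desc m)"

lemma sep_le: "sep m a b \<Longrightarrow> a \<le> b \<Longrightarrow> m \<le> b"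
  using desc_ge unfolding sep_def by fastforce

lemma sep_commute: "sep m a b \<longleftrightarrow> sep m b a"
  by (auto simp: sep_def)

text \<open>The tube of \<open>b\<close> is connected and has points on both sides of the cut at
  \<open>m\<close>.\<close>

lemma rel_sep:
  assumes "N \<in> mnest" "b \<in> {1..n}" "rel N a b" "sep m a b"
  shows "rel N m b"
proof -
  have "subtree (own N b)" using mnest_subtree[OF assms(1) own_in[OF assms(1,2)]] .
  moreover have "a \<in> own N b" "b \<in> own N b"
    using innerD(2) assms(3) own_inner[OF assms(2)] unfolding rel_def by auto
  ultimately show ?thesis
    using subtree_separates[of "own N b"] assms(4) unfolding rel_def sep_def by blast
qed

text \<open>By injectivity of \<open>own\<close>, only \<open>m\<close> owns this tube, so no edge
  of the component does.\<close>

lemma comp_own_subset: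
  assumes "N \<in> mnest" "m \<in> {1..n}" "x \<in> inner (own N m)" "x \<noteq> m"
  shows "\<exists>Q\<in>N. comp (own N m) m x \<subseteq> Q \<and> Q \<subset> own N m"
proof -
  let ?S = "own N m"
  have S: "?S \<in> N" "subtree ?S" "m \<in> inner ?S" "?S \<subseteq> {..n}"
    using own_in[OF assms(1,2)] own_inner[OF assms(2)] mnest_subtree[OF assms(1)]
      mnest_subset[OF assms(1)] by blast+
  note i = inner_comp[OF S(4,3)]
  show ?thesis
  proof (rule subset_proper_tube[OF assms(1) S(1) subtree_comp[OF S(2,3)] comp_subset])
    show "x \<in> inner (comp ?S m x)" using i assms by simp
    show "own N y \<noteq> ?S" if "y \<in> inner (comp ?S m x)" for y
      using that i own_inj[of N y m] assms mnest_inner[OF assms(1) S(1)] by blast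
  qed
qed

text \<open>If the owner \<open>m\<close> of the smallest tube around both edges were off the path,
  deleting \<open>m\<close> would leave \<open>a\<close> and \<open>b\<close> in one component,
  which fits into a smaller tube.\<close>

lemma path_max:
  assumes "N \<in> mnest" "a \<in> {1..n}" "b \<in> {1..n}"
  obtains m where "m \<in> {1..n}" "m = a \<or> m = b \<or> sep m a b" "rel N a m" "rel N b m"
proof -
  let ?C = "{S \<in> N. a \<in> inner S \<and> b \<in> inner S}"
  have "finite ?C" using mnest_finite[OF assms(1)] by simp
  moreover have "{..n} \<in> ?C" using mnest_whole[OF assms(1)] inner_whole assms by blast
  ultimately obtain S where S: "S \<in> ?C" "\<And>R. R \<in> ?C \<Longrightarrow> R \<subseteq> S \<Longrightarrow> S = R"
    using finite_has_minimal[of ?C] by blast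
  obtain m where m: "m \<in> {1..n}" "own N m = S" using own_surj[OF assms(1)] S(1) by blast
  have "m = a \<or> m = b \<or> sep m a b"
  proof (rule ccontr)
    assume no: "\<not> ?thesis"
    have "m \<in> inner S" "S \<subseteq> {..n}"
      using own_inner[OF m(1)] m(2) mnest_subset[OF assms(1)] S(1) by blast+
    note i = inner_comp[OF this(2,1)]
    obtain Q where Q: "Q \<in> N" "comp S m a \<subseteq> Q" "Q \<subset> S"
      using comp_own_subset[OF assms(1) m(1), of a] m(2) S(1) no by blast
    have "a \<in> inner (comp S m a)" "b \<in> inner (comp S m a)"
      using i S(1) no unfolding sep_def by blast+
    then have "Q \<in> ?C" using Q(1) inner_mono[OF Q(2)] by blast
    then show False using S(2)[of Q] Q(3) by blast
  qed
  then show ?thesis using that[of m] m S(1) unfolding rel_def by blast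
qed

definition cov :: "nat set set \<Rightarrow> nat \<Rightarrow> nat \<Rightarrow> bool" where
  "cov N f e \<longleftrightarrow> f \<in> {1..n} \<and> e \<in> {1..n} \<and> f \<noteq> e \<and> rel N f e \<and>
     (\<forall>x\<in>{1..n}. rel N f x \<and> rel N x e \<longrightarrow> x = f \<or> x = e)"

lemma covD:
  assumes "cov N f e"
  shows "f \<in> {1..n}" "e \<in> {1..n}" "f \<noteq> e" "rel N f e"
    and "x \<in> {1..n} \<Longrightarrow> rel N f x \<Longrightarrow> rel N x e \<Longrightarrow> x = f \<or> x = e"
  using assms by (auto simp: cov_def)

lemma cov_exists:
  assumes "N \<in> mnest" "f \<in> {1..n}" "S \<in> N" "own N f \<subset> S"
  obtains e where "cov N f e" "own N e \<subseteq> S"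
proof -
  define C where "C = {R \<in> N. own N f \<subset> R}"
  have "finite C" using mnest_finite[OF assms(1)] by (simp add: C_def)
  moreover have "S \<in> C" using assms(3,4) by (simp add: C_def)
  ultimately obtain R where R: "R \<in> C" "R \<subseteq> S" "\<And>X. X \<in> C \<Longrightarrow> X \<subseteq> R \<Longrightarrow> R = X"
    using finite_has_minimal2[of C S] by metis
  have RN: "R \<in> N" "own N f \<subset> R" using R(1) by (simp_all add: C_def)
  obtain e where e: "e \<in> {1..n}" "own N e = R" using own_surj[OF assms(1) RN(1)] by blast
  have "x = f \<or> x = e" if x: "x \<in> {1..n}" "rel N f x" "rel N x e" for x
  proof -
    have "own N f \<subseteq> own N x" "own N x \<subseteq> own N e"
      using rel_iff[OF assms(1,2) x(1)] rel_iff[OF assms(1) x(1) e(1)] x by blast+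
    then have "own N x = own N f \<or> own N x = own N e"
      using R(3)[of "own N x"] e(2) own_in[OF assms(1) x(1)] unfolding C_def by blast
    then show ?thesis
      using own_inj[OF assms(1) x(1) e(1)] own_inj[OF assms(1) x(1) assms(2)] by blast
  qed
  moreover have "rel N f e" "f \<noteq> e" using rel_iff[OF assms(1,2) e(1)] e(2) RN(2) by blast+
  ultimately have "cov N f e" using assms(2) e(1) by (simp add: cov_def)
  then show ?thesis using that[of e] e(2) R(2) by simp
qed

text \<open>The component lies in a tube strictly inside that of \<open>e\<close>; the owner of this
  tube is between \<open>f\<close> and \<open>e\<close>, so it is \<open>f\<close>. Conversely, the
  tube of \<open>f\<close> does not contain the edge \<open>e\<close> and stays on one side of it.
  Hence a tube has at most two maximal tubes inside it.\<close>

lemma own_cov: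
  assumes "N \<in> mnest" "cov N f e"
  shows "own N f = comp (own N e) e f"
proof
  note c = covD[OF assms(2)]
  obtain Q where Q: "Q \<in> N" "comp (own N e) e f \<subseteq> Q" "Q \<subset> own N e"
    using comp_own_subset[OF assms(1) c(2) c(4)[unfolded rel_def] c(3)] by (elim bexE conjE)
  obtain q where q: "q \<in> {1..n}" "own N q = Q" using own_surj[OF assms(1) Q(1)] by blast
  have e: "e \<in> inner (own N e)" "own N e \<subseteq> {..n}"
    using own_inner[OF c(2)] subsetD[OF mnest_subset[OF assms(1)] own_in[OF assms(1) c(2)]]
    by auto
  have "f \<in> inner (comp (own N e) e f)"
    using inner_comp[OF e(2,1)] c(3,4) by (simp add: rel_def)
  then have "rel N f q" using q inner_mono[OF Q(2)] unfolding rel_def by blast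
  moreover have "rel N q e" using rel_iff[OF assms(1) q(1) c(2)] q(2) Q(3) by simp
  ultimately have "q = f" using c(5)[OF q(1)] Q(3) q(2) by auto
  then show "comp (own N e) e f \<subseteq> own N f" using Q q by blast
  show "own N f \<subseteq> comp (own N e) e f"
  proof
    fix v assume v: "v \<in> own N f"
    have "f \<in> own N f" using own_inner[OF c(1)] innerD(2) by blast
    moreover have "e \<notin> inner (own N f)"
      using rel_antisym[OF assms(1) c(2,4)] c(3) unfolding rel_def by blast
    ultimately have "v \<in> desc e \<longleftrightarrow> f \<in> desc e"
      using subtree_separates[OF mnest_subtree[OF assms(1) own_in[OF assms(1) c(1)]]] v by blast
    moreover have "v \<in> own N e" using v iffD1[OF rel_iff[OF assms(1) c(1,2)] c(4)] by blast
    ultimately show "v \<in> comp (own N e) e f" by (simp add: in_comp)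
  qed
qed

section \<open>Flips\<close>

lemma own_insert:
  "own (insert X C) b = (if b \<in> inner X then X \<inter> own C b else own C b)"
  by (auto simp: own_def)

text \<open>Only \<open>f\<close> loses its tube. The remaining tubes around \<open>f\<close> belong
  to edges strictly above \<open>f\<close>; these form a chain starting with
  \<open>e\<close>.\<close>

lemma own_remove:
  assumes "N \<in> mnest" "cov N f e" "b \<in> {1..n}"
  shows "own (N - {own N f}) b = own N (if b = f then e else b)"
proof -
  note c = covD[OF assms(2)]
  let ?b = "if b = f then e else b"
  have b': "?b \<in> {1..n}" using assms(3) c by simp
  have "own N ?b \<noteq> own N f" using own_inj[OF assms(1) b' c(1)] c(3) by simp
  then have in_set: "own N ?b \<in> N - {own N f}" using own_in[OF assms(1) b'] by blast
  moreover have inn: "b \<in> inner (own N ?b)"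
    using c(4) own_inner[OF assms(3)] unfolding rel_def by simp
  moreover have "own N ?b \<subseteq> S" if S: "S \<in> N - {own N f}" "b \<in> inner S" for S
  proof (cases "b = f")
    case False
    then show ?thesis using own_least S by simp
  next
    case True
    obtain s where s: "s \<in> {1..n}" "own N s = S" using own_surj[OF assms(1)] S(1) by blast
    have "rel N f s" using S(2) True s(2) by (simp add: rel_def)
    then have "rel N e s"
      using rel_forest[OF assms(1) c(2) s(1) c(4)] c(5)[OF s(1)] S(1) s rel_refl by blast
    then show ?thesis using rel_iff[OF assms(1) c(2) s(1)] s True by simp
  qed
  ultimately show ?thesis unfolding own_def[of "N - {own N f}"] by blast
qed

text \<open>The tube of \<open>f\<close> is what remains around \<open>f\<close> when the tube of
  \<open>e\<close> is cut at \<open>e\<close>. The flip cuts the same tube at \<open>f\<close>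
  instead and keeps the part around \<open>e\<close>.\<close>

definition flip :: "nat set set \<Rightarrow> nat \<Rightarrow> nat \<Rightarrow> nat set set" where
  "flip N f e = insert (comp (own N e) f e) (N - {own N f})"

context
  fixes N f e
  assumes N: "N \<in> mnest" and cov: "cov N f e"
begin

lemma flip_tube_inner: "y \<in> inner (comp (own N e) f e) \<longleftrightarrow>
    rel N y e \<and> y \<noteq> f \<and> (y \<in> desc f \<longleftrightarrow> e \<in> desc f)"
proof -
  have "own N e \<subseteq> {..n}" using own_in mnest_subset N covD[OF cov] by blast
  moreover have "f \<in> inner (own N e)" using covD(4)[OF cov] by (simp add: rel_def)
  ultimately show ?thesis using inner_comp unfolding rel_def by blast
qed

lemma flip_tube_in: "e \<in> inner (comp (own N e) f e)"
  using flip_tube_inner rel_refl covD[OF cov] by blast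

text \<open>The new tube contains the edge \<open>e\<close> but not \<open>f\<close>, whereas every
  tube of \<open>N\<close> around \<open>e\<close> contains \<open>own N e\<close> and so
  \<open>f\<close>.\<close>

lemma flip_tube_notin: "comp (own N e) f e \<notin> N"
  using own_least[of "comp (own N e) f e" N e] flip_tube_in flip_tube_inner[of f]
    covD(4)[OF cov] inner_mono unfolding rel_def by blast

text \<open>Nothing lies strictly between \<open>f\<close> and \<open>e\<close>, so the tube of
  \<open>b\<close> does not contain the edge \<open>f\<close> and the cut at \<open>f\<close> leaves
  it in one piece.\<close>

lemma desc_below_cov:
  assumes "b \<in> {1..n}" "rel N b e" "b \<noteq> e" "b \<noteq> f" "v \<in> own N b"
  shows "v \<in> desc f \<longleftrightarrow> b \<in> desc f"
proof -
  have "f \<notin> inner (own N b)"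
    using covD(5)[OF cov assms(1)] assms unfolding rel_def by blast
  moreover have "subtree (own N b)" "b \<in> own N b"
    using mnest_subtree own_in own_inner innerD N assms(1) by blast+
  ultimately show ?thesis using subtree_separates assms(5) by blast
qed

lemma flip_tube_laminar:
  assumes "S \<in> N" "S \<noteq> own N f"
  shows "comp (own N e) f e \<subseteq> S \<or> S \<subseteq> comp (own N e) f e \<or> S \<inter> comp (own N e) f e = {}"
proof -
  note c = covD[OF cov]
  obtain b where b: "b \<in> {1..n}" "own N b = S" using own_surj[OF N assms(1)] by blast
  consider "own N e \<subseteq> S" | "S \<inter> own N e = {}" | "S \<subset> own N e"
    using mnest_laminar[OF N assms(1) own_in[OF N c(2)]] by blast
  then show ?thesis
  proof cases
    case 1
    then show ?thesis using comp_subset by blast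
  next
    case 2
    then show ?thesis using comp_subset by blast
  next
    case 3
    then have "rel N b e" using rel_iff[OF N b(1) c(2)] b by blast
    moreover have "b \<noteq> e" "b \<noteq> f" using 3 b assms(2) by auto
    ultimately have "v \<in> desc f \<longleftrightarrow> b \<in> desc f" if "v \<in> S" for v
      using desc_below_cov b that by blast
    then show ?thesis using 3 by (auto simp: in_comp)
  qed
qed

lemma flip_mnest: "flip N f e \<in> mnest"
proof -
  note c = covD[OF cov]
  have f: "own N f \<in> N" "f \<in> inner (own N e)"
    using own_in[OF N c(1)] c(4) by (simp_all add: rel_def)
  have t: "subtree (comp (own N e) f e)"
    using subtree_comp[OF mnest_subtree[OF N own_in[OF N c(2)]] f(2)] .
  have "card (flip N f e) = Suc (card (N - {own N f}))"
    unfolding flip_def using flip_tube_notin mnest_finite[OF N] by simp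
  then have "card (flip N f e) = n"
    using card_Suc_Diff1[OF mnest_finite[OF N] f(1)] mnest_card[OF N] by simp
  moreover have "{..n} \<in> flip N f e"
  proof -
    have "own N f \<subseteq> own N e" "own N f \<noteq> own N e"
      using rel_iff[OF N c(1,2)] own_inj[OF N c(1,2)] c(3,4) by simp_all
    then have "own N f \<noteq> {..n}" using subsetD[OF mnest_subset[OF N] own_in[OF N c(2)]] by auto
    then show ?thesis using mnest_whole[OF N] by (simp add: flip_def)
  qed
  moreover have "subtree S \<and> 2 \<le> card S" if "S \<in> flip N f e" for S
    using that t card_inner[OF t flip_tube_in] mnest_subtree[OF N] mnest_card_ge[OF N]
    unfolding flip_def by blast
  moreover have "S \<subseteq> S' \<or> S' \<subseteq> S \<or> S \<inter> S' = {}"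
    if "S \<in> flip N f e" "S' \<in> flip N f e" for S S'
    using that flip_tube_laminar mnest_laminar[OF N, of S S'] unfolding flip_def by blast
  ultimately show ?thesis unfolding mnest_def by blast
qed

lemma own_flip:
  assumes "b \<in> {1..n}"
  shows "own (flip N f e) b =
    (if b = f then own N e else if b = e then comp (own N e) f e else own N b)"
proof -
  note c = covD[OF cov]
  let ?X = "comp (own N e) f e"
  have *: "own (flip N f e) b =
    (if b \<in> inner ?X then ?X \<inter> own (N - {own N f}) b else own (N - {own N f}) b)"
    unfolding flip_def by (rule own_insert)
  consider "b = f" | "b = e" | "b \<noteq> e" "b \<noteq> f" by blast
  then show ?thesis
  proof cases
    case 1
    then show ?thesis using * own_remove[OF N cov assms] flip_tube_inner[of f] by simp
  next
    case 2
    then have "?X \<inter> own N b = ?X" using comp_subset by blast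
    then show ?thesis using * own_remove[OF N cov assms] flip_tube_in c(3) 2 by simp
  next
    case 3
    have "?X \<inter> own N b = own N b" if bX: "b \<in> inner ?X"
    proof -
      have b: "rel N b e" "b \<in> desc f \<longleftrightarrow> e \<in> desc f" using flip_tube_inner bX by blast+
      then have "v \<in> desc f \<longleftrightarrow> e \<in> desc f" if "v \<in> own N b" for v
        using desc_below_cov[OF assms b(1) 3 that] by blast
      then show ?thesis using b(1) rel_iff[OF N assms c(2)] by (auto simp: in_comp)
    qed
    then show ?thesis using * own_remove[OF N cov assms] 3 by simp
  qed
qed

lemma rel_flip:
  assumes "b \<in> {1..n}"
  shows "rel (flip N f e) a b \<longleftrightarrow>
    (if b = f then rel N a e
     else if b = e then rel N a e \<and> a \<noteq> f \<and> (a \<in> desc f \<longleftrightarrow> e \<in> desc f)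
     else rel N a b)"
  using own_flip[OF assms] flip_tube_inner unfolding rel_def by auto

text \<open>Since \<open>f < e\<close>, the edge \<open>f\<close> is outside \<open>desc e\<close>.
  Its tube is therefore the upper part of the tube of \<open>e\<close> cut at \<open>e\<close>, and
  \<open>a\<close> is in that part.\<close>

lemma not_in_desc_above:
  assumes "f < e" "rel N a e" "a \<notin> desc e"
  shows "rel N a f"
proof -
  note c = covD[OF cov]
  have e: "own N e \<subseteq> {..n}" "e \<in> inner (own N e)"
    using subsetD[OF mnest_subset[OF N] own_in[OF N c(2)]] own_inner[OF c(2)] by auto
  have "f \<notin> desc e" using assms(1) desc_ge[of f e] by auto
  moreover have "a \<noteq> e" using assms(3) desc_self c(2) by auto
  ultimately have "a \<in> inner (comp (own N e) e f)"
    using inner_comp[OF e, of a f] assms by (simp add: rel_def)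
  then show ?thesis using own_cov[OF N cov] by (simp add: rel_def)
qed

text \<open>As \<open>f < e\<close>, the edge \<open>f\<close> is not a descendant of \<open>e\<close>, so everything that the flip adds to the
  tube of \<open>f\<close> descends from \<open>e\<close>; this is what makes the comparison through least elements work.\<close>

lemma flip_tube_less:
  assumes "f < e"
  shows "\<exists>a\<in>own N f - comp (own N e) f e. \<forall>b\<in>comp (own N e) f e - own N f. a < b"
proof -
  note c = covD[OF cov]
  have "f \<notin> desc e" using assms desc_ge[of f e] by auto
  then have of: "own N f = own N e - desc e" using own_cov[OF N cov] by (simp add: comp_def)
  have ff: "f \<in> own N f" "par f \<in> own N f" using own_inner[OF c(1), of N] by (simp_all add: inner_def)
  have pf: "par f < f" "par f \<notin> desc f" "f \<in> desc f"
    using par_less[of f] par_notin_desc[of f] desc_self[of f] c(1) by simp_all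
  have b: "e \<le> b" if "b \<in> comp (own N e) f e - own N f" for b
    using that of desc_ge by (auto simp: in_comp)
  show ?thesis
  proof (cases "e \<in> desc f")
    case True
    then have "par f \<in> own N f - comp (own N e) f e" using ff pf by (simp add: in_comp)
    moreover have "par f < e" using pf assms by simp
    ultimately show ?thesis using b less_le_trans by blast
  next
    case False
    then have "f \<in> own N f - comp (own N e) f e" using ff pf by (simp add: in_comp)
    then show ?thesis using b assms less_le_trans by blast
  qed
qed

end

text \<open>For a star, \<open>rel N\<close> is a total order and these are the noninversions of a
  permutation; the order on nestings then becomes the weak order.\<close>

definition lower_pairs :: "nat set set \<Rightarrow> (nat \<times> nat) set" where
  "lower_pairs N = {(a, b). a \<in> {1..n} \<and> b \<in> {1..n} \<and> a < b \<and> rel N a b}"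

lemma lower_pairs_iff:
  "(a, b) \<in> lower_pairs N \<longleftrightarrow> a \<in> {1..n} \<and> b \<in> {1..n} \<and> a < b \<and> rel N a b"
  by (simp add: lower_pairs_def)

lemma finite_lower_pairs: "finite (lower_pairs N)"
  by (rule finite_subset[of _ "{1..n} \<times> {1..n}"]) (auto simp: lower_pairs_def)

definition up_cov :: "nat set set \<Rightarrow> nat \<Rightarrow> nat \<Rightarrow> bool" where
  "up_cov N f e \<longleftrightarrow> cov N f e \<and> f < e"

lemma lower_pairs_flip:
  assumes "N \<in> mnest" "up_cov N f e"
  shows "lower_pairs (flip N f e) \<subseteq> lower_pairs N" "(f, e) \<in> lower_pairs N"
    "(f, e) \<notin> lower_pairs (flip N f e)"
proof -
  have u: "cov N f e" "f < e" using assms(2) by (auto simp: up_cov_def)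
  note c = covD[OF u(1)]
  note r = rel_flip[OF assms(1) u(1)]
  show "(f, e) \<in> lower_pairs N" using c u(2) by (simp add: lower_pairs_iff)
  show "(f, e) \<notin> lower_pairs (flip N f e)" using r[OF c(2), of f] c(3) by (simp add: lower_pairs_iff)
  have "rel N a b" if ab: "a \<in> {1..n}" "b \<in> {1..n}" "a < b" "rel (flip N f e) a b" for a b
  proof (cases "b = f")
    case True
    have "rel N a e" using r[OF ab(2), of a] ab(4) True by simp
    moreover have "a \<notin> desc e" using ab(3) True u(2) desc_ge[of a e] by auto
    ultimately show ?thesis using not_in_desc_above[OF assms(1) u] True by blast
  next
    case False
    then show ?thesis using r[OF ab(2), of a] ab(4) by (auto split: if_splits)
  qed
  then show "lower_pairs (flip N f e) \<subseteq> lower_pairs N" by (auto simp: lower_pairs_def)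
qed

text \<open>The flip loses only pairs \<open>(a, e)\<close> where \<open>a\<close> is
  \<open>f\<close> or is separated from \<open>e\<close> by \<open>f\<close>. If \<open>M\<close>
  had such a pair, \<open>rel_sep\<close> would give it \<open>(f, e)\<close> as well.\<close>

lemma lower_pairs_flip_greatest:
  assumes "N \<in> mnest" "up_cov N f e" "M \<in> mnest"
    and sub: "lower_pairs M \<subseteq> lower_pairs N" "(f, e) \<notin> lower_pairs M"
  shows "lower_pairs M \<subseteq> lower_pairs (flip N f e)"
proof (rule subsetI, clarify)
  fix a b assume ab: "(a, b) \<in> lower_pairs M"
  have u: "cov N f e" "f < e" using assms(2) by (auto simp: up_cov_def)
  note c = covD[OF u(1)]
  have M: "a \<in> {1..n}" "b \<in> {1..n}" "a < b" "rel M a b"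
    using ab by (simp_all add: lower_pairs_iff)
  have Nab: "rel N a b" using subsetD[OF sub(1) ab] by (simp add: lower_pairs_iff)
  have "rel (flip N f e) a b"
  proof (cases "b = e")
    case True
    have "\<not> rel M f e" using sub(2) c u(2) by (simp add: lower_pairs_iff)
    then have "a \<noteq> f" "\<not> sep f a e" using M True rel_sep[OF assms(3) M(2)] by blast+
    then show ?thesis
      using rel_flip[OF assms(1) u(1) M(2), of a] Nab True c(3) by (simp add: sep_def)
  next
    case False
    then show ?thesis
      using rel_flip[OF assms(1) u(1) M(2), of a] Nab rel_trans[OF assms(1) c(2) _ c(4)]
      by auto
  qed
  then show "(a, b) \<in> lower_pairs (flip N f e)" using M by (simp add: lower_pairs_iff)
qed

section \<open>The order and local joins\<close>

lemma lower_pairs_subsetD: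
  assumes "lower_pairs M \<subseteq> lower_pairs N" "a \<in> {1..n}" "b \<in> {1..n}" "a < b" "rel M a b"
  shows "rel N a b"
proof -
  have "(a, b) \<in> lower_pairs M" using assms(2-5) by (simp add: lower_pairs_iff)
  then have "(a, b) \<in> lower_pairs N" using assms(1) by (rule rev_subsetD)
  then show ?thesis by (simp add: lower_pairs_iff)
qed

lemma cov_exists_below:
  assumes "N \<in> mnest" "b \<in> {1..n}" "rel N m b" "m \<noteq> b"
  obtains f where "cov N f b" "rel N m f"
proof -
  have m: "m \<in> {1..n}" using rel_range[OF assms(1-3)] .
  define C where "C = {S \<in> N. own N m \<subseteq> S \<and> S \<subset> own N b}"
  have "finite C" using mnest_finite[OF assms(1)] by (simp add: C_def)
  moreover have "own N m \<in> C"
    using own_in[OF assms(1) m] rel_iff[OF assms(1) m assms(2)] own_inj[OF assms(1) m assms(2)]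
      assms(3,4) by (simp add: C_def psubset_eq)
  ultimately obtain S where S: "S \<in> C" "\<And>R. R \<in> C \<Longrightarrow> S \<subseteq> R \<Longrightarrow> S = R"
    using finite_has_maximal[of C] by (metis empty_iff)
  have SN: "S \<in> N" "own N m \<subseteq> S" "S \<subset> own N b" using S(1) by (simp_all add: C_def)
  obtain f where f: "f \<in> {1..n}" "own N f = S" using own_surj[OF assms(1) SN(1)] by blast
  have "x = f \<or> x = b" if x: "x \<in> {1..n}" "rel N f x" "rel N x b" for x
  proof -
    have "own N f \<subseteq> own N x" "own N x \<subseteq> own N b"
      using rel_iff[OF assms(1) f(1) x(1)] rel_iff[OF assms(1) x(1) assms(2)] x by blast+
    then have "own N x = own N f \<or> own N x = own N b"
      using S(2)[of "own N x"] f(2) own_in[OF assms(1) x(1)] SN(2) unfolding C_def by blast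
    then show ?thesis
      using own_inj[OF assms(1) x(1) f(1)] own_inj[OF assms(1) x(1) assms(2)] by blast
  qed
  moreover have "rel N f b" "f \<noteq> b" "rel N m f"
    using rel_iff[OF assms(1) f(1) assms(2)] rel_iff[OF assms(1) m f(1)] f(2) SN(2,3) by blast+
  ultimately show ?thesis using that[of f] f(1) assms(2) by (simp add: cov_def)
qed

text \<open>Choose \<open>(a, b)\<close> in the difference of the two sets such that the tube of \<open>b\<close> is minimal, and
  replace \<open>a\<close> by the largest edge (with respect to \<open>M\<close>) of the path from \<open>a\<close> to \<open>b\<close>. Then the child of \<open>b\<close>
  whose tube contains \<open>a\<close> can be flipped.\<close>

lemma up_cov_avoiding:
  assumes N: "N \<in> mnest" and M: "M \<in> mnest"
    and sub: "lower_pairs M \<subseteq> lower_pairs N" and not_sub: "\<not> lower_pairs N \<subseteq> lower_pairs M"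
  obtains f e where "up_cov N f e" "(f, e) \<notin> lower_pairs M"
proof -
  define P where "P b \<longleftrightarrow> (\<exists>a. (a, b) \<in> lower_pairs N - lower_pairs M)" for b
  have "\<exists>b. P b" using not_sub unfolding P_def by auto
  then obtain b where b: "P b" "\<And>y. P y \<Longrightarrow> card (own N b) \<le> card (own N y)"
    using ex_has_least_nat[of P _ "\<lambda>b. card (own N b)"] by blast
  obtain a where a: "(a, b) \<in> lower_pairs N" "(a, b) \<notin> lower_pairs M"
    using b(1) unfolding P_def by blast
  have ab: "a \<in> {1..n}" "b \<in> {1..n}" "a < b" "rel N a b" "\<not> rel M a b"
    using a by (auto simp: lower_pairs_iff)
  \<comment> \<open>Minimality of the tube of \<open>b\<close>: no pair of \<open>N\<close> whose
    upper edge is strictly below \<open>b\<close> is missing in \<open>M\<close>.\<close>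
  have below: "rel M x y"
    if y: "y \<in> {1..n}" "rel N y b" "y \<noteq> b" and x: "x \<in> {1..n}" "x < y" "rel N x y" for x y
  proof (rule ccontr)
    assume "\<not> rel M x y"
    then have "P y" using x y(1) unfolding P_def by (auto simp: lower_pairs_iff)
    then have "card (own N b) \<le> card (own N y)" using b(2) by blast
    moreover have "own N y \<subset> own N b"
      using rel_iff[OF N y(1) ab(2)] own_inj[OF N y(1) ab(2)] y(2,3) by (simp add: psubset_eq)
    moreover have "finite (own N b)" using subtree_finite[OF mnest_subtree[OF N own_in[OF N ab(2)]]] .
    ultimately show False using psubset_card_mono[of "own N b" "own N y"] by simp
  qed
  obtain m where m: "m \<in> {1..n}" "m = a \<or> m = b \<or> sep m a b" "rel M a m" "rel M b m"
    using path_max[OF M ab(1,2)] by blast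
  have mb: "m \<noteq> b" using m(3) ab(5) by blast
  have m_less: "m < b" using m(2) mb ab(3) sep_le[of m a b] by auto
  have Nmb: "rel N m b" using m(2) mb ab(4) rel_sep[OF N ab(2) ab(4)] by blast
  obtain f where f: "cov N f b" "rel N m f" using cov_exists_below[OF N ab(2) Nmb mb] by blast
  note c = covD(1-4)[OF f(1)]
  \<comment> \<open>If \<open>b < f\<close>, then \<open>m < f\<close>, so \<open>below\<close> puts
    \<open>m\<close> under \<open>f\<close> in \<open>M\<close>. As \<open>b\<close> is under
    \<open>m\<close> there, \<open>(b, f)\<close> is a pair of \<open>M\<close> and hence of
    \<open>N\<close>, contradicting that \<open>f\<close> is below \<open>b\<close>.\<close>
  have "f < b"
  proof (rule ccontr)
    assume "\<not> f < b"
    then have fb: "b < f" using c(3) by simp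
    then have "rel M m f" using below[OF c(1,4,3) m(1)] m_less f(2) by simp
    then have "rel M b f" using rel_trans[OF M c(1) m(4)] by blast
    then have "rel N b f" using lower_pairs_subsetD[OF sub c(2,1) fb] by blast
    then show False using rel_antisym[OF N c(2,4)] c(3) by blast
  qed
  then have up: "up_cov N f b" using f(1) by (simp add: up_cov_def)
  have "(f, b) \<notin> lower_pairs M"
  proof
    assume "(f, b) \<in> lower_pairs M"
    then have Mfb: "rel M f b" by (simp add: lower_pairs_iff)
    then have Mfm: "rel M f m" using rel_trans[OF M m(1) _ m(4)] by blast
    have fm: "f \<noteq> m" using rel_antisym[OF M ab(2) Mfb] m(4) mb by blast
    consider "f < m" | "m < f" using fm by linarith
    then show False
    proof cases
      case 1
      then have "rel N f m" using lower_pairs_subsetD[OF sub c(1) m(1)] Mfm by blast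
      then show False using rel_antisym[OF N c(1) f(2)] fm by blast
    next
      case 2
      then have "rel M m f" using below[OF c(1,4,3) m(1)] f(2) by blast
      then show False using rel_antisym[OF M m(1) Mfm] fm by blast
    qed
  qed
  then show ?thesis using that up by blast
qed

text \<open>Only \<open>a < b\<close> is in question. In \<open>M\<close> some edge \<open>m\<close>
  of the path is above both and differs from both; in \<open>N\<close>, \<open>rel_sep\<close> puts
  \<open>m\<close> below \<open>a\<close>. So \<open>N\<close> and \<open>M\<close> order
  \<open>a\<close> and \<open>m\<close> oppositely, and whichever of the two is smaller, this shows
  in \<open>lower_pairs\<close>.\<close>

lemma rel_eq_of_lower_pairs:
  assumes N: "N \<in> mnest" and M: "M \<in> mnest" and eq: "lower_pairs N = lower_pairs M"
    and a: "a \<in> {1..n}" and ba: "rel N b a"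
  shows "rel M b a"
proof (rule ccontr)
  assume no: "\<not> rel M b a"
  have b: "b \<in> {1..n}" using rel_range[OF N a ba] .
  have LR: "rel N x y \<longleftrightarrow> rel M x y" if "x \<in> {1..n}" "y \<in> {1..n}" "x < y" for x y
    using eq that lower_pairs_iff[of x y N] lower_pairs_iff[of x y M] by simp
  have neq: "a \<noteq> b" using no rel_refl[OF a] by blast
  have ab: "a < b" using LR[OF b a] ba no neq by linarith
  obtain m where m: "m \<in> {1..n}" "m = a \<or> m = b \<or> sep m a b" "rel M a m" "rel M b m"
    using path_max[OF M a b] by blast
  have ma: "m \<noteq> a" using m(4) no by blast
  have "m \<noteq> b" using m(3) LR[OF a b ab] rel_antisym[OF N a ba] neq by blast
  then have "sep m b a" using m(2) ma sep_commute by blast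
  then have Nma: "rel N m a" using rel_sep[OF N a ba] by blast
  consider "a < m" | "m < a" using ma by linarith
  then show False
  proof cases
    case 1
    then have "rel N a m" using LR[OF a m(1)] m(3) by blast
    then show False using rel_antisym[OF N a Nma] ma by blast
  next
    case 2
    then have "rel M m a" using LR[OF m(1) a] Nma by blast
    then show False using rel_antisym[OF M m(1) m(3)] ma by blast
  qed
qed

lemma lower_pairs_inj:
  assumes N: "N \<in> mnest" and M: "M \<in> mnest" and eq: "lower_pairs N = lower_pairs M"
  shows "N = M"
proof -
  have "own N a = own M a" if a: "a \<in> {1..n}" for a
  proof (rule subtree_eqI)
    show "inner (own N a) = inner (own M a)"
      using rel_eq_of_lower_pairs[OF N M eq a] rel_eq_of_lower_pairs[OF M N eq[symmetric] a]
      unfolding rel_def by blast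
    show "subtree (own N a)" "subtree (own M a)"
      using mnest_subtree[OF N own_in[OF N a]] mnest_subtree[OF M own_in[OF M a]] .
    show "2 \<le> card (own N a)" "2 \<le> card (own M a)"
      using mnest_card_ge[OF N own_in[OF N a]] mnest_card_ge[OF M own_in[OF M a]] .
  qed
  then have "own N ` {1..n} = own M ` {1..n}" by simp
  then show ?thesis using own_image[OF N] own_image[OF M] by simp
qed

section \<open>The order as reverse inclusion of lower pairs\<close>

definition up_step :: "nat set set \<Rightarrow> nat set set \<Rightarrow> bool" where
  "up_step N N' \<longleftrightarrow> N \<in> mnest \<and> (\<exists>f e. up_cov N f e \<and> N' = flip N f e)"

lemma up_stepD:
  assumes "up_step N N'"
  shows "N' \<in> mnest" "lower_pairs N' \<subset> lower_pairs N"
proof -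
  obtain f e where fe: "N \<in> mnest" "up_cov N f e" "N' = flip N f e"
    using assms unfolding up_step_def by blast
  show "N' \<in> mnest" using flip_mnest fe by (simp add: up_cov_def)
  show "lower_pairs N' \<subset> lower_pairs N" using lower_pairs_flip[OF fe(1,2)] fe(3) by blast
qed

lemma up_step_exists:
  assumes "N \<in> mnest" "M \<in> mnest" "lower_pairs M \<subseteq> lower_pairs N" "N \<noteq> M"
  obtains N' where "up_step N N'" "lower_pairs M \<subseteq> lower_pairs N'"
proof -
  have "\<not> lower_pairs N \<subseteq> lower_pairs M"
    using lower_pairs_inj[OF assms(1,2)] assms(3,4) by blast
  then obtain f e where "up_cov N f e" "(f, e) \<notin> lower_pairs M"
    using up_cov_avoiding[OF assms(1-3)] by blast
  then show ?thesis
    using that[of "flip N f e"] lower_pairs_flip_greatest[OF assms(1) _ assms(2,3)] assms(1)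
    unfolding up_step_def by blast
qed

text \<open>As long as \<open>N\<close> differs from \<open>M\<close>, some upward flip of
  \<open>N\<close> drops a pair absent from \<open>M\<close>. It stays below \<open>M\<close> by
  \<open>lower_pairs_flip_greatest\<close>, and the finite set of pairs shrinks strictly.\<close>

lemma rtranclp_up_step_iff:
  assumes "N \<in> mnest" "M \<in> mnest"
  shows "up_step\<^sup>*\<^sup>* N M \<longleftrightarrow> lower_pairs M \<subseteq> lower_pairs N"
proof
  assume "up_step\<^sup>*\<^sup>* N M"
  then show "lower_pairs M \<subseteq> lower_pairs N"
    by (induction rule: rtranclp_induct) (use up_stepD in blast)+
next
  assume "lower_pairs M \<subseteq> lower_pairs N"
  then show "up_step\<^sup>*\<^sup>* N M"
    using assms(1)
  proof (induction "card (lower_pairs N)" arbitrary: N rule: less_induct)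
    case less
    show ?case
    proof (cases "N = M")
      case False
      obtain N' where N': "up_step N N'" "lower_pairs M \<subseteq> lower_pairs N'"
        using up_step_exists[OF less.prems(2) assms(2) less.prems(1) False] by blast
      have "card (lower_pairs N') < card (lower_pairs N)"
        using up_stepD(2)[OF N'(1)] finite_lower_pairs by (simp add: psubset_card_mono)
      then have "up_step\<^sup>*\<^sup>* N' M" using less.hyps N'(2) up_stepD(1)[OF N'(1)] by blast
      then show ?thesis using N'(1) by (simp add: converse_rtranclp_into_rtranclp)
    qed simp
  qed
qed

section \<open>Joins of two upward flips of one nesting\<close>

lemma up_cov_commute:
  assumes z: "z \<in> mnest" and u: "up_cov z f1 e1" "up_cov z f2 e2"
    and d: "f1 \<noteq> f2" "e1 \<noteq> e2" "f1 \<noteq> e2" "f2 \<noteq> e1"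
  shows "up_cov (flip z f1 e1) f2 e2"
proof -
  have c: "cov z f1 e1" "cov z f2 e2" "f2 < e2" using u by (simp_all add: up_cov_def)
  note c1 = covD[OF c(1)] and c2 = covD[OF c(2)]
  note r = rel_flip[OF z c(1)]
  have re2: "rel (flip z f1 e1) y e2 \<longleftrightarrow> rel z y e2" for y
    using r[OF c2(2), of y] d(2,3) by simp
  \<comment> \<open>Only the tube of \<open>f1\<close> has grown, so only \<open>y = f1\<close>
    could be new between \<open>f2\<close> and \<open>e2\<close>. That would place \<open>e1\<close>
    strictly between them already in \<open>z\<close>.\<close>
  have "y = f2 \<or> y = e2"
    if y: "y \<in> {1..n}" "rel (flip z f1 e1) f2 y" "rel (flip z f1 e1) y e2" for y
  proof -
    have ye: "rel z y e2" using y(3) re2 by simp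
    consider "y = f1" | "y \<noteq> f1" "rel z f2 y" using r[OF y(1), of f2] y(2) by (auto split: if_splits)
    then show ?thesis
    proof cases
      case 1
      then have "rel z f2 e1" using r[OF y(1), of f2] y(2) by simp
      moreover have "\<not> rel z e2 e1" using c1(5)[OF c2(2)] ye 1 d(2,3) by blast
      then have "rel z e1 e2" using rel_forest[OF z c1(2) c2(2) c1(4)] ye 1 by blast
      ultimately show ?thesis using c2(5)[OF c1(2)] d by blast
    next
      case 2
      then show ?thesis using c2(5)[OF y(1)] ye by blast
    qed
  qed
  then show ?thesis using c2(1-4) re2 c(3) unfolding up_cov_def cov_def by blast
qed

lemma up_cov_upper_unique:
  assumes "z \<in> mnest" "up_cov z f e1" "up_cov z f e2"
  shows "e1 = e2"
proof -
  have c: "cov z f e1" "cov z f e2" using assms by (simp_all add: up_cov_def)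
  note c1 = covD[OF c(1)] and c2 = covD[OF c(2)]
  show ?thesis
    using rel_forest[OF assms(1) c1(2) c2(2) c1(4) c2(4)] c1(5)[OF c2(2) c2(4)]
      c2(5)[OF c1(2) c1(4)] c1(3) c2(3) by blast
qed

text \<open>Cutting the tube of \<open>e\<close> at \<open>e\<close> leaves two parts, and an edge
  smaller than \<open>e\<close> can only own the part outside \<open>desc e\<close>.\<close>

lemma up_cov_lower_unique:
  assumes "z \<in> mnest" "up_cov z f1 e" "up_cov z f2 e"
  shows "f1 = f2"
proof -
  have c: "cov z f1 e" "cov z f2 e" "f1 < e" "f2 < e" using assms by (simp_all add: up_cov_def)
  have "f2 \<notin> desc e" using c(4) desc_ge[of f2 e] by auto
  then have "rel z f2 f1" using not_in_desc_above[OF assms(1) c(1,3)] covD(4)[OF c(2)] by blast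
  then show ?thesis using covD(5)[OF c(2) covD(1)[OF c(1)]] covD(3,4)[OF c(1)] by blast
qed

text \<open>This replaces the transitivity of inversions. If \<open>f\<close> were below
  \<open>e\<close> in \<open>M\<close>, apply \<open>path_max\<close> to \<open>g\<close> and
  \<open>e\<close>: the resulting \<open>m\<close> separates \<open>g\<close> from both
  \<open>f\<close> and \<open>e\<close>, and \<open>f < m\<close>. Carried back to \<open>z\<close>,
  it lies strictly between \<open>f\<close> and its cover \<open>g\<close>.\<close>

lemma up_cov_chain_avoids:
  assumes z: "z \<in> mnest" and u: "up_cov z f g" "up_cov z g e" and M: "M \<in> mnest"
    and sub: "lower_pairs M \<subseteq> lower_pairs z"
      "(f, g) \<notin> lower_pairs M" "(g, e) \<notin> lower_pairs M"
  shows "(f, e) \<notin> lower_pairs M"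
proof
  assume "(f, e) \<in> lower_pairs M"
  then have fe: "rel M f e" by (simp add: lower_pairs_iff)
  have c: "cov z f g" "cov z g e" "f < g" "g < e" using u by (simp_all add: up_cov_def)
  note c1 = covD[OF c(1)] and c2 = covD[OF c(2)]
  have no: "\<not> rel M f g" "\<not> rel M g e" using sub(2,3) c1(1,2) c2(2) c(3,4) by (auto simp: lower_pairs_iff)
  obtain m where m: "m \<in> {1..n}" "m = g \<or> m = e \<or> sep m g e" "rel M g m" "rel M e m"
    using path_max[OF M c2(1,2)] by blast
  have fm: "rel M f m" using rel_trans[OF M m(1) fe m(4)] .
  have me: "m \<noteq> e" "m \<noteq> g" using m(3) no(2) fm no(1) by blast+
  then have s1: "sep m g e" using m(2) by blast
  have s2: "\<not> sep m f e" using rel_sep[OF M c2(2) fe] rel_antisym[OF M c2(2) _ m(4)] me(1) by blast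
  \<comment> \<open>Otherwise \<open>m <= f < g < e\<close>. As \<open>desc m\<close> is an interval
    starting at \<open>m\<close>, it cannot separate \<open>g\<close> from both \<open>f\<close> and
    \<open>e\<close>.\<close>
  have "f < m"
  proof (rule ccontr)
    assume "\<not> f < m"
    then have "m \<le> f" by simp
    then have "e \<in> desc m \<Longrightarrow> g \<in> desc m" "g \<in> desc m \<Longrightarrow> f \<in> desc m"
      using desc_convex[of e m g] desc_convex[of g m f] c(3,4) by simp_all
    then show False using s1 s2 unfolding sep_def by blast
  qed
  then have "rel z f m" using lower_pairs_subsetD[OF sub(1) c1(1) m(1)] fm by blast
  moreover have "sep m f g" using s1 s2 unfolding sep_def by blast
  then have "rel z m g" using rel_sep[OF z c1(2,4)] by blast
  ultimately show False using c1(5)[OF m(1)] me(2) \<open>f < m\<close> by blast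
qed

text \<open>Going up shrinks \<open>lower_pairs\<close>, so the join has the largest set contained
  in both; this may be smaller than their intersection.\<close>

definition is_join :: "nat set set \<Rightarrow> nat set set \<Rightarrow> nat set set \<Rightarrow> bool" where
  "is_join x y t \<longleftrightarrow> t \<in> mnest \<and> lower_pairs t \<subseteq> lower_pairs x \<and> lower_pairs t \<subseteq> lower_pairs y \<and>
     (\<forall>M\<in>mnest. lower_pairs M \<subseteq> lower_pairs x \<longrightarrow> lower_pairs M \<subseteq> lower_pairs y \<longrightarrow>
        lower_pairs M \<subseteq> lower_pairs t)"

lemma is_join_commute: "is_join x y t \<Longrightarrow> is_join y x t"
  by (simp add: is_join_def)

lemma join_commuting_flips:
  assumes z: "z \<in> mnest" and u: "up_cov z f1 e1" "up_cov z f2 e2"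
    and d: "f1 \<noteq> f2" "e1 \<noteq> e2" "f1 \<noteq> e2" "f2 \<noteq> e1"
  shows "is_join (flip z f1 e1) (flip z f2 e2) (flip (flip z f1 e1) f2 e2)"
proof -
  let ?x = "flip z f1 e1" and ?y = "flip z f2 e2"
  let ?t = "flip ?x f2 e2"
  have x: "?x \<in> mnest" using flip_mnest[OF z] u by (simp add: up_cov_def)
  have ux: "up_cov ?x f2 e2" using up_cov_commute[OF z u d] .
  have t: "?t \<in> mnest" using flip_mnest[OF x] ux by (simp add: up_cov_def)
  note lt = lower_pairs_flip[OF x ux] and lx = lower_pairs_flip[OF z u(1)]
    and ly = lower_pairs_flip[OF z u(2)]
  have "lower_pairs ?t \<subseteq> lower_pairs ?y"
    using lower_pairs_flip_greatest[OF z u(2) t] lt(1,3) lx(1) by blast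
  moreover have "lower_pairs M \<subseteq> lower_pairs ?t"
    if "M \<in> mnest" "lower_pairs M \<subseteq> lower_pairs ?x" "lower_pairs M \<subseteq> lower_pairs ?y" for M
    using lower_pairs_flip_greatest[OF x ux that(1,2)] that(3) ly(3) by blast
  ultimately show ?thesis using t lt(1) unfolding is_join_def by blast
qed

text \<open>Flipping \<open>f\<close> past \<open>g\<close> makes \<open>e\<close> cover
  \<open>f\<close>, so \<open>f\<close> can be flipped past \<open>e\<close> next. Common upper
  bounds survive this second flip because they lack \<open>(f, e)\<close> by
  \<open>up_cov_chain_avoids\<close>.\<close>

lemma join_chain_flips:
  assumes z: "z \<in> mnest" and u: "up_cov z f g" "up_cov z g e"
  obtains t where "is_join (flip z f g) (flip z g e) t"
proof -
  define x where "x = flip z f g"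
  define x' where "x' = flip x f e"
  let ?y = "flip z g e"
  have c: "cov z f g" "cov z g e" "f < g" "g < e" using u by (simp_all add: up_cov_def)
  note c1 = covD[OF c(1)] and c2 = covD[OF c(2)]
  have fe: "rel z f e" "f \<noteq> e" using rel_trans[OF z c2(2) c1(4) c2(4)] c(3,4) by simp_all
  have x: "x \<in> mnest" unfolding x_def using flip_mnest[OF z c(1)] .
  note r = rel_flip[OF z c(1), folded x_def]
  have re: "rel x y e \<longleftrightarrow> rel z y e" for y using r[OF c2(2), of y] c2(3) fe(2) by simp
  have "y = f \<or> y = e" if y: "y \<in> {1..n}" "rel x f y" "rel x y e" for y
  proof (cases "y = f")
    case False
    then have fy: "y \<noteq> g" "rel z f y" using r[OF y(1), of f] y(2) by (auto split: if_splits)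
    have ye: "rel z y e" using y(3) re by simp
    show ?thesis
      using rel_forest[OF z c1(2) y(1) c1(4) fy(2)] c2(5)[OF y(1) _ ye] c1(5)[OF y(1) fy(2)]
        fy(1) False by blast
  qed simp
  then have "cov x f e" using c1(1) c2(2) fe re unfolding cov_def by blast
  then have ux: "up_cov x f e" using c(3,4) by (simp add: up_cov_def)
  have x': "x' \<in> mnest" unfolding x'_def using flip_mnest[OF x \<open>cov x f e\<close>] .
  note r' = rel_flip[OF x \<open>cov x f e\<close>, folded x'_def]
  note lx = lower_pairs_flip[OF z u(1), folded x_def] and ly = lower_pairs_flip[OF z u(2)]
    and lx' = lower_pairs_flip[OF x ux, folded x'_def]
  have above: "lower_pairs M \<subseteq> lower_pairs x'"
    if M: "M \<in> mnest" "lower_pairs M \<subseteq> lower_pairs x" "lower_pairs M \<subseteq> lower_pairs ?y" for M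
  proof -
    have "(f, e) \<notin> lower_pairs M"
      using up_cov_chain_avoids[OF z u M(1)] M(2,3) lx(1,3) ly(3) by blast
    then show ?thesis
      using lower_pairs_flip_greatest[OF x ux M(1,2), folded x'_def] by blast
  qed
  show ?thesis
  \<comment> \<open>If \<open>f\<close> separates \<open>g\<close> from \<open>e\<close>, the second
    flip has already removed \<open>g\<close> from the tube of \<open>e\<close>; otherwise a third
    flip is needed to drop \<open>(g, e)\<close>.\<close>
  proof (cases "(g, e) \<in> lower_pairs x'")
    case False
    have "lower_pairs x' \<subseteq> lower_pairs ?y"
      using lower_pairs_flip_greatest[OF z u(2) x'] lx'(1) lx(1) False by blast
    then have "is_join x ?y x'" using above x' lx'(1) unfolding is_join_def by blast
    then show ?thesis using that unfolding x_def by blast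
  next
    case True
    then have ge: "rel x' g e" by (simp add: lower_pairs_iff)
    have "y = g \<or> y = e" if y: "y \<in> {1..n}" "rel x' g y" "rel x' y e" for y
    proof (cases "y = e \<or> y = g")
      case False
      have "rel x y e" "y \<noteq> f" using r'[OF c2(2), of y] y(3) fe(2) by (auto split: if_splits)
      moreover have "rel z g y"
        using r'[OF y(1), of g] r[OF y(1), of g] y(2) False \<open>y \<noteq> f\<close> by simp
      ultimately show ?thesis using c2(5)[OF y(1)] re by blast
    qed blast
    then have "cov x' g e" using c2(1-3) ge unfolding cov_def by blast
    then have ux': "up_cov x' g e" using c(4) by (simp add: up_cov_def)
    let ?t = "flip x' g e"
    have t: "?t \<in> mnest" using flip_mnest[OF x' \<open>cov x' g e\<close>] .
    note lt = lower_pairs_flip[OF x' ux']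
    have "lower_pairs ?t \<subseteq> lower_pairs x" using lt(1) lx'(1) by blast
    moreover have "lower_pairs ?t \<subseteq> lower_pairs ?y"
      using lower_pairs_flip_greatest[OF z u(2) t] calculation lx(1) lt(3) by blast
    moreover have "lower_pairs M \<subseteq> lower_pairs ?t"
      if M: "M \<in> mnest" "lower_pairs M \<subseteq> lower_pairs x" "lower_pairs M \<subseteq> lower_pairs ?y" for M
      using lower_pairs_flip_greatest[OF x' ux' M(1) above[OF M]] M(3) ly(3) by blast
    ultimately have "is_join x ?y ?t" using t unfolding is_join_def by blast
    then show ?thesis using that unfolding x_def by blast
  qed
qed

lemma join_up_steps:
  assumes "up_step z x" "up_step z y"
  obtains t where "is_join x y t"
proof -
  obtain f1 e1 f2 e2 where z: "z \<in> mnest" and u: "up_cov z f1 e1" "up_cov z f2 e2"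
    and xy: "x = flip z f1 e1" "y = flip z f2 e2"
    using assms unfolding up_step_def by blast
  consider "f1 = f2" | "f1 \<noteq> f2" "e1 = e2" | "f2 = e1" | "f1 = e2"
    | "f1 \<noteq> f2" "e1 \<noteq> e2" "f1 \<noteq> e2" "f2 \<noteq> e1" by blast
  then show ?thesis
  proof cases
    case 1
    then have "x = y" using up_cov_upper_unique[OF z, of f1 e1 e2] u xy by simp
    then have "is_join x y x" using up_stepD(1)[OF assms(1)] by (simp add: is_join_def)
    then show ?thesis by (rule that)
  next
    case 2
    then show ?thesis using up_cov_lower_unique[OF z u(1), of f2] u(2) by simp
  next
    case 3
    then have "up_cov z e1 e2" using u(2) by simp
    then obtain t where "is_join (flip z f1 e1) (flip z e1 e2) t"
      by (rule join_chain_flips[OF z u(1)])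
    then show ?thesis using xy 3 that by simp
  next
    case 4
    then have "up_cov z e2 e1" using u(1) by simp
    then obtain t where "is_join (flip z f2 e2) (flip z e2 e1) t"
      by (rule join_chain_flips[OF z u(2)])
    then have "is_join y x t" using xy 4 by simp
    then show ?thesis by (rule that[OF is_join_commute])
  next
    case 5
    then have "is_join x y (flip x f2 e2)" using join_commuting_flips[OF z u] xy by simp
    then show ?thesis by (rule that)
  qed
qed

section \<open>The lattice property\<close>

lemma exchange_cov:
  assumes N: "N \<in> mnest" and N': "N' \<in> mnest"
    and t: "\<tau> \<in> N - N'" "\<tau>' \<in> N' - N" "N - {\<tau>} = N' - {\<tau>'}"
  obtains f e where "cov N f e" "cov N' e f" "\<tau> = own N f" "\<tau>' = own N' e" "own N e = own N' f"
proof -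
  have upper: "\<exists>f e. own M f = S \<and> cov M f e" if M: "M \<in> mnest" "S \<in> M" "S \<noteq> {..n}" for M S
  proof -
    obtain f where f: "f \<in> {1..n}" "own M f = S" using own_surj[OF M(1,2)] .
    have "own M f \<subset> {..n}"
      using subsetD[OF mnest_subset[OF M(1)] M(2)] M(3) f(2) by (simp add: psubset_eq)
    then obtain e where "cov M f e" using cov_exists[OF M(1) f(1) mnest_whole[OF M(1)]] by blast
    then show ?thesis using f(2) by blast
  qed
  have "\<tau> \<noteq> {..n}" "\<tau>' \<noteq> {..n}" using t(1,2) mnest_whole[OF N] mnest_whole[OF N'] by blast+
  then obtain f e f' e' where fe: "own N f = \<tau>" "cov N f e" and fe': "own N' f' = \<tau>'" "cov N' f' e'"
    using upper[OF N, of \<tau>] upper[OF N', of \<tau>'] t(1,2) by blast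
  note c = covD[OF fe(2)] and c' = covD[OF fe'(2)]
  \<comment> \<open>The owner map of the common collection, computed from either side. Evaluating it
    at \<open>f\<close> and at \<open>e\<close> forces \<open>f' = e\<close> and
    \<open>e' = f\<close>, unless \<open>f' = f\<close>, which would make the two tubes
    equal.\<close>
  have same: "own N (if b = f then e else b) = own N' (if b = f' then e' else b)"
    if "b \<in> {1..n}" for b
    using own_remove[OF N fe(2) that] own_remove[OF N' fe'(2) that] fe(1) fe'(1) t(3) by simp
  have "f' \<noteq> f"
  proof
    assume ff: "f' = f"
    have e: "own N e = own N' e" using same[OF c(2)] ff c(3) by simp
    moreover have "own N e = own N' e'" using same[OF c(1)] ff by simp
    ultimately have "e' = e" using own_inj[OF N' c(2) c'(2)] by simp
    then have "own N f = own N' f" using own_cov[OF N fe(2)] own_cov[OF N' fe'(2)] e ff by simp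
    then show False using fe(1) fe'(1) ff t(1,2) by simp
  qed
  then have o: "own N e = own N' f" using same[OF c(1)] by simp
  have e: "f' = e"
  proof (rule ccontr)
    assume "f' \<noteq> e"
    then have "own N e = own N' e" using same[OF c(2)] c(3) by simp
    then show False using o own_inj[OF N' c(1,2)] c(3) by simp
  qed
  then have "own N' e' = own N' f" using same[OF c(2)] c(3) o by simp
  then have "e' = f" using own_inj[OF N' c'(2) c(1)] by simp
  then have "cov N' e f" using fe'(2) e by simp
  moreover have "\<tau>' = own N' e" using fe'(1) e by simp
  ultimately show ?thesis using that[OF fe(2) _ fe(1)[symmetric] _ o] by blast
qed

text \<open>An exchange is a flip at \<open>f\<close> and \<open>e\<close> read from
  \<open>N\<close>, and at \<open>e\<close> and \<open>f\<close> read from \<open>N'\<close>.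
  \<open>flip_tube_less\<close> applies to whichever reading is upward, so comparing least elements
  detects whether \<open>f < e\<close>.\<close>

lemma exchange_iff_up_step:
  assumes N: "N \<in> mnest" and N': "N' \<in> mnest"
  shows "(\<exists>\<tau>\<in>N - N'. \<exists>\<tau>'\<in>N' - N. N - {\<tau>} = N' - {\<tau>'} \<and> (\<exists>a\<in>\<tau> - \<tau>'. \<forall>b\<in>\<tau>' - \<tau>. a < b))
    \<longleftrightarrow> up_step N N'"
proof
  assume "\<exists>\<tau>\<in>N - N'. \<exists>\<tau>'\<in>N' - N. N - {\<tau>} = N' - {\<tau>'} \<and> (\<exists>a\<in>\<tau> - \<tau>'. \<forall>b\<in>\<tau>' - \<tau>. a < b)"
  then obtain \<tau> where "\<tau> \<in> N - N'"
    and "\<exists>\<tau>'\<in>N' - N. N - {\<tau>} = N' - {\<tau>'} \<and> (\<exists>a\<in>\<tau> - \<tau>'. \<forall>b\<in>\<tau>' - \<tau>. a < b)" ..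
  moreover from this(2) obtain \<tau>' where "\<tau>' \<in> N' - N"
    and "N - {\<tau>} = N' - {\<tau>'} \<and> (\<exists>a\<in>\<tau> - \<tau>'. \<forall>b\<in>\<tau>' - \<tau>. a < b)" ..
  moreover from this(2) obtain a where a: "a \<in> \<tau> - \<tau>'" "\<forall>b\<in>\<tau>' - \<tau>. a < b" by blast
  ultimately have t: "\<tau> \<in> N - N'" "\<tau>' \<in> N' - N" "N - {\<tau>} = N' - {\<tau>'}" by simp_all
  obtain f e where fe: "cov N f e" "cov N' e f" "\<tau> = own N f" "\<tau>' = own N' e" "own N e = own N' f"
    using exchange_cov[OF N N' t] .
  have comp: "\<tau> = comp (own N' f) e f" "\<tau>' = comp (own N e) f e"
    using own_cov[OF N fe(1)] own_cov[OF N' fe(2)] fe(3-5) by simp_all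
  have "f < e"
  proof (rule ccontr)
    assume "\<not> f < e"
    then have "e < f" using covD(3)[OF fe(1)] by simp
    then obtain a' where a': "a' \<in> \<tau>' - \<tau>" "\<forall>b\<in>\<tau> - \<tau>'. a' < b"
      using flip_tube_less[OF N' fe(2)] fe(4) comp(1) by metis
    have "a < a'" using a(2) a'(1) by blast
    moreover have "a' < a" using a(1) a'(2) by blast
    ultimately show False by simp
  qed
  moreover have "N' = flip N f e"
    unfolding flip_def using t fe(3) comp(2) by (metis DiffD1 insert_Diff)
  ultimately show "up_step N N'" using N fe(1) unfolding up_step_def up_cov_def by blast
next
  assume "up_step N N'"
  then obtain f e where fe: "cov N f e" "f < e" "N' = flip N f e"
    unfolding up_step_def up_cov_def by blast
  let ?t = "comp (own N e) f e"
  note c = covD[OF fe(1)]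
  have "own N f \<noteq> ?t" using own_inner[OF c(1), of N] flip_tube_inner[OF N fe(1), of f] by auto
  moreover have "?t \<notin> N" using flip_tube_notin[OF N fe(1)] .
  moreover have "own N f \<in> N" using own_in[OF N c(1)] .
  ultimately have "own N f \<in> N - N'" "?t \<in> N' - N" "N - {own N f} = N' - {?t}"
    unfolding fe(3) flip_def by auto
  then show "\<exists>\<tau>\<in>N - N'. \<exists>\<tau>'\<in>N' - N. N - {\<tau>} = N' - {\<tau>'} \<and> (\<exists>a\<in>\<tau> - \<tau>'. \<forall>b\<in>\<tau>' - \<tau>. a < b)"
    using flip_tube_less[OF N fe(1,2)] by blast
qed

section \<open>The least element, and all joins and meets\<close>

definition initial_segments :: "nat set set" where
  "initial_segments = (\<lambda>k. {..k}) ` {1..n}"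

text \<open>Prefixes of the preorder are connected because parents come earlier. Every pair
  \<open>a < b\<close> is a lower pair of this nesting, so it will serve as the least
  element.\<close>

lemma initial_segments_mnest:
  assumes "0 < n"
  shows "initial_segments \<in> mnest"
proof -
  have "par v \<le> k" if "v \<le> k" "0 < v" "k \<le> n" for v k
    using par_less[of v] that by simp
  then have "subtree {..k} \<and> 2 \<le> card {..k}" if "k \<in> {1..n}" for k
    using that unfolding subtree_def by (auto intro!: bexI[of _ 0])
  then have "\<forall>S\<in>initial_segments. subtree S \<and> 2 \<le> card S"
    by (simp add: initial_segments_def)
  moreover have "card initial_segments = n"
    unfolding initial_segments_def by (subst card_image) (auto simp: inj_on_def)
  moreover have "{..n} \<in> initial_segments"
    using assms by (auto simp: initial_segments_def)
  moreover have "\<forall>S\<in>initial_segments. \<forall>S'\<in>initial_segments. S \<subseteq> S' \<or> S' \<subseteq> S \<or> S \<inter> S' = {}"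
    by (auto simp: initial_segments_def)
  ultimately show ?thesis by (simp add: mnest_def)
qed

lemma lower_pairs_initial_segments: "lower_pairs N \<subseteq> lower_pairs initial_segments"
proof -
  have "rel initial_segments a b" if "a \<in> {1..n}" "b \<in> {1..n}" "a < b" for a b
    using that par_less[of a] by (auto simp: rel_def own_def initial_segments_def inner_def)
  then show ?thesis by (auto simp: lower_pairs_def)
qed

text \<open>The theorem of Bjorner, Edelman and Ziegler: in a finite poset with a least element, joins
  exist as soon as they exist for any two upper covers of a common element.\<close>

lemma join_above:
  assumes "z \<in> mnest" "x \<in> mnest" "y \<in> mnest"
    and "lower_pairs x \<subseteq> lower_pairs z" "lower_pairs y \<subseteq> lower_pairs z"
  shows "\<exists>t. is_join x y t"
  using assms
proof (induction "card (lower_pairs z)" arbitrary: z x y rule: less_induct)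
  case less
  have z: "z \<in> mnest" and x: "x \<in> mnest" and y: "y \<in> mnest" using less.prems by blast+
  have smaller: "card (lower_pairs w) < card (lower_pairs z)" if "up_step z w" for w
    using up_stepD(2)[OF that] finite_lower_pairs by (simp add: psubset_card_mono)
  consider "x = z" | "y = z" | "z \<noteq> x" "z \<noteq> y" by blast
  then show ?case
  proof cases
    case 1
    then have "is_join x y y" using less.prems by (simp add: is_join_def)
    then show ?thesis ..
  next
    case 2
    then have "is_join x y x" using less.prems by (simp add: is_join_def)
    then show ?thesis ..
  next
    case 3
    obtain x1 where x1: "up_step z x1" "lower_pairs x \<subseteq> lower_pairs x1"
      using up_step_exists[OF z x less.prems(4) 3(1)] .
    obtain y1 where y1: "up_step z y1" "lower_pairs y \<subseteq> lower_pairs y1"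
      using up_step_exists[OF z y less.prems(5) 3(2)] .
    \<comment> \<open>The induction hypothesis applies only above \<open>x1\<close> or
      \<open>y1\<close>. The join \<open>j\<close> links them: \<open>x\<close> and \<open>j\<close>
      are above \<open>x1\<close>, and their join \<open>p\<close> is above \<open>y1\<close>, as is
      \<open>y\<close>.\<close>
    obtain j where j: "is_join x1 y1 j" using join_up_steps[OF x1(1) y1(1)] .
    note x1m = up_stepD(1)[OF x1(1)] and y1m = up_stepD(1)[OF y1(1)]
    have jm: "j \<in> mnest" "lower_pairs j \<subseteq> lower_pairs x1" "lower_pairs j \<subseteq> lower_pairs y1"
      using j by (simp_all add: is_join_def)
    obtain p where p: "is_join x j p"
      using less.hyps[OF smaller[OF x1(1)] x1m x jm(1) x1(2) jm(2)] by blast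
    have pm: "p \<in> mnest" "lower_pairs p \<subseteq> lower_pairs x" "lower_pairs p \<subseteq> lower_pairs y1"
      using p jm(3) unfolding is_join_def by blast+
    obtain t where t: "is_join p y t"
      using less.hyps[OF smaller[OF y1(1)] y1m pm(1) y pm(3) y1(2)] by blast
    have tm: "t \<in> mnest" "lower_pairs t \<subseteq> lower_pairs x" "lower_pairs t \<subseteq> lower_pairs y"
      using t pm(2) unfolding is_join_def by blast+
    have "lower_pairs M \<subseteq> lower_pairs t"
      if M: "M \<in> mnest" "lower_pairs M \<subseteq> lower_pairs x" "lower_pairs M \<subseteq> lower_pairs y" for M
    proof -
      have "lower_pairs M \<subseteq> lower_pairs j"
        using j M x1(2) y1(2) unfolding is_join_def by (meson order_trans)
      then have "lower_pairs M \<subseteq> lower_pairs p" using p M unfolding is_join_def by blast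
      then show ?thesis using t M unfolding is_join_def by blast
    qed
    then have "is_join x y t" using tm unfolding is_join_def by blast
    then show ?thesis ..
  qed
qed

text \<open>For \<open>n = 0\<close> there are no nestings in \<open>mnest\<close>, and
  \<open>initial_segments\<close> is empty, so positivity is read off from a given member.\<close>

lemma mnest_pos: "N \<in> mnest \<Longrightarrow> 0 < n"
  using mnest_card[of N] mnest_finite[of N] mnest_whole[of N] card_gt_0_iff[of N] by auto

lemma join_exists:
  assumes "x \<in> mnest" "y \<in> mnest"
  shows "\<exists>t. is_join x y t"
  using join_above[OF initial_segments_mnest[OF mnest_pos[OF assms(1)]] assms]
    lower_pairs_initial_segments by blast

lemma finite_join_exists:
  assumes "finite B" "B \<noteq> {}" "B \<subseteq> mnest"
  shows "\<exists>t\<in>mnest. (\<forall>b\<in>B. lower_pairs t \<subseteq> lower_pairs b) \<and>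
    (\<forall>M\<in>mnest. (\<forall>b\<in>B. lower_pairs M \<subseteq> lower_pairs b) \<longrightarrow> lower_pairs M \<subseteq> lower_pairs t)"
  using assms
proof (induction B rule: finite_ne_induct)
  case (singleton x)
  then show ?case by auto
next
  case (insert x F)
  then obtain s where s: "s \<in> mnest" "\<forall>b\<in>F. lower_pairs s \<subseteq> lower_pairs b"
    "\<forall>M\<in>mnest. (\<forall>b\<in>F. lower_pairs M \<subseteq> lower_pairs b) \<longrightarrow> lower_pairs M \<subseteq> lower_pairs s"
    by auto
  have "x \<in> mnest" using insert.prems by simp
  then obtain t where t: "is_join x s t" using join_exists[OF _ s(1)] by blast
  have "t \<in> mnest" using t by (simp add: is_join_def)
  moreover have "lower_pairs t \<subseteq> lower_pairs x" "lower_pairs t \<subseteq> lower_pairs s"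
    using t by (simp_all add: is_join_def)
  then have "\<forall>b\<in>insert x F. lower_pairs t \<subseteq> lower_pairs b" using s(2) by auto
  moreover have "lower_pairs M \<subseteq> lower_pairs t"
    if M: "M \<in> mnest" "\<forall>b\<in>insert x F. lower_pairs M \<subseteq> lower_pairs b" for M
  proof -
    have "lower_pairs M \<subseteq> lower_pairs s" using s(3) M by simp
    moreover have "lower_pairs M \<subseteq> lower_pairs x" using M(2) by simp
    ultimately show ?thesis using t M(1) unfolding is_join_def by blast
  qed
  ultimately show ?case by blast
qed

text \<open>The meet is the join of all common lower bounds, a finite set that contains the least
  element.\<close>

lemma meet_exists:
  assumes "x \<in> mnest" "y \<in> mnest"
  shows "\<exists>t\<in>mnest. lower_pairs x \<subseteq> lower_pairs t \<and> lower_pairs y \<subseteq> lower_pairs t \<and>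
    (\<forall>M\<in>mnest. lower_pairs x \<subseteq> lower_pairs M \<longrightarrow> lower_pairs y \<subseteq> lower_pairs M \<longrightarrow>
      lower_pairs t \<subseteq> lower_pairs M)"
proof -
  define B where "B = {M \<in> mnest. lower_pairs x \<subseteq> lower_pairs M \<and> lower_pairs y \<subseteq> lower_pairs M}"
  have "finite B" using finite_mnest by (simp add: B_def)
  moreover have "initial_segments \<in> B"
    using initial_segments_mnest[OF mnest_pos[OF assms(1)]] lower_pairs_initial_segments
    by (simp add: B_def)
  then have "B \<noteq> {}" by blast
  moreover have "B \<subseteq> mnest" by (simp add: B_def)
  ultimately have "\<exists>t\<in>mnest. (\<forall>b\<in>B. lower_pairs t \<subseteq> lower_pairs b) \<and>
    (\<forall>M\<in>mnest. (\<forall>b\<in>B. lower_pairs M \<subseteq> lower_pairs b) \<longrightarrow> lower_pairs M \<subseteq> lower_pairs t)"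
    by (rule finite_join_exists)
  then obtain t where t: "t \<in> mnest" "\<forall>b\<in>B. lower_pairs t \<subseteq> lower_pairs b"
    "\<forall>M\<in>mnest. (\<forall>b\<in>B. lower_pairs M \<subseteq> lower_pairs b) \<longrightarrow> lower_pairs M \<subseteq> lower_pairs t"
    by (elim bexE conjE)
  have "x \<in> mnest" "\<forall>b\<in>B. lower_pairs x \<subseteq> lower_pairs b"
    and "y \<in> mnest" "\<forall>b\<in>B. lower_pairs y \<subseteq> lower_pairs b"
    using assms by (simp_all add: B_def)
  then have "lower_pairs x \<subseteq> lower_pairs t" "lower_pairs y \<subseteq> lower_pairs t"
    using t(3) by simp_all
  moreover have "\<forall>M\<in>mnest. lower_pairs x \<subseteq> lower_pairs M \<longrightarrow> lower_pairs y \<subseteq> lower_pairs M \<longrightarrow>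
      lower_pairs t \<subseteq> lower_pairs M"
    using t(2) by (simp add: B_def)
  ultimately show ?thesis using t(1) by (intro bexI[of _ t] conjI)
qed

lemma lattice_mnest: "lattice \<lparr>carrier = mnest, eq = (=), le = up_step\<^sup>*\<^sup>*\<rparr>"
  (is "lattice ?L")
proof -
  note le = rtranclp_up_step_iff
  have upper: "Upper ?L {x, y} =
      {u \<in> mnest. lower_pairs u \<subseteq> lower_pairs x \<and> lower_pairs u \<subseteq> lower_pairs y}"
    if "x \<in> mnest" "y \<in> mnest" for x y
  proof (rule Set.set_eqI)
    fix u
    show "u \<in> Upper ?L {x, y} \<longleftrightarrow> u \<in> {u \<in> mnest. lower_pairs u \<subseteq> lower_pairs x \<and> lower_pairs u \<subseteq> lower_pairs y}"
      using that le[of x u] le[of y u] le[of u x] le[of u y]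
      by (cases "u \<in> mnest") (simp_all add: Upper_def all_conj_distrib)
  qed
  have lower: "Lower ?L {x, y} =
      {l \<in> mnest. lower_pairs x \<subseteq> lower_pairs l \<and> lower_pairs y \<subseteq> lower_pairs l}"
    if "x \<in> mnest" "y \<in> mnest" for x y
  proof (rule Set.set_eqI)
    fix u
    show "u \<in> Lower ?L {x, y} \<longleftrightarrow> u \<in> {u \<in> mnest. lower_pairs x \<subseteq> lower_pairs u \<and> lower_pairs y \<subseteq> lower_pairs u}"
      using that le[of x u] le[of y u] le[of u x] le[of u y]
      by (cases "u \<in> mnest") (simp_all add: Lower_def all_conj_distrib)
  qed
  have "partial_order ?L"
  proof
    fix x y assume "x \<sqsubseteq>\<^bsub>?L\<^esub> y" "y \<sqsubseteq>\<^bsub>?L\<^esub> x" "x \<in> carrier ?L" "y \<in> carrier ?L"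
    then show "x .=\<^bsub>?L\<^esub> y" using le lower_pairs_inj[of x y] by simp
  qed auto
  moreover have "\<exists>s. least ?L s (Upper ?L {x, y})" "\<exists>s. greatest ?L s (Lower ?L {x, y})"
    if "x \<in> carrier ?L" "y \<in> carrier ?L" for x y
  proof -
    have xy: "x \<in> mnest" "y \<in> mnest" using that by simp_all
    obtain t where "is_join x y t" using join_exists[OF xy] by blast
    then have "least ?L t (Upper ?L {x, y})"
      unfolding least_def upper[OF xy] is_join_def by (simp add: le Collect_restrict)
    then show "\<exists>s. least ?L s (Upper ?L {x, y})" ..
    obtain s where "s \<in> mnest" "lower_pairs x \<subseteq> lower_pairs s \<and> lower_pairs y \<subseteq> lower_pairs s \<and>
      (\<forall>M\<in>mnest. lower_pairs x \<subseteq> lower_pairs M \<longrightarrow> lower_pairs y \<subseteq> lower_pairs M \<longrightarrow>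
        lower_pairs s \<subseteq> lower_pairs M)"
      using meet_exists[OF xy] ..
    then have "greatest ?L s (Lower ?L {x, y})"
      unfolding greatest_def lower[OF xy] by (simp add: le Collect_restrict)
    then show "\<exists>s. greatest ?L s (Lower ?L {x, y})" ..
  qed
  ultimately show ?thesis
    by (intro lattice.intro upper_semilattice.intro lower_semilattice.intro
      upper_semilattice_axioms.intro lower_semilattice_axioms.intro)
qed

section \<open>Connectivity expressed by parents\<close>

lemma connected_iff_subtree:
  assumes E: "E = {(par v, v) |v. v \<in> {1..n}}" and S: "S \<subseteq> {..n}"
  shows "S \<noteq> {} \<and> (\<forall>u\<in>S. \<forall>w\<in>S. (u, w) \<in> ((E \<union> E\<inverse>) \<inter> S \<times> S)\<^sup>*) \<longleftrightarrow> subtree S"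
    (is "?con \<longleftrightarrow> _")
proof
  let ?R = "(E \<union> E\<inverse>) \<inter> S \<times> S"
  assume con: ?con
  define r where "r = Min S"
  have fin: "finite S" using S finite_subset by blast
  have r: "r \<in> S" "\<And>v. v \<in> S \<Longrightarrow> r \<le> v" using con fin by (simp_all add: r_def)
  have "par v \<in> S" if v: "v \<in> S" "v \<noteq> r" for v
  proof (rule ccontr)
    assume no: "par v \<notin> S"
    have vn: "v \<le> n" using S v(1) by blast
    \<comment> \<open>The only edge leaving \<open>desc v\<close> leads to \<open>par v\<close>,
      which is missing from \<open>S\<close>, so walks from \<open>v\<close> within \<open>S\<close>
      never reach the smaller vertex \<open>r\<close>.\<close>
    have "w \<in> desc v" if "(v, w) \<in> ?R\<^sup>*" for w
      using that
    proof (induction rule: rtrancl_induct)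
      case base
      show ?case using desc_self vn .
    next
      case (step x y)
      then have "x \<in> S" "y \<in> S"
        and "x = par y \<and> y \<in> {1..n} \<or> y = par x \<and> x \<in> {1..n}" using E by auto
      then show ?case
        using step.IH no par_in_desc_iff[of y v] par_in_desc_iff[of x v] by (cases "x = v"; cases "y = v") auto
    qed
    then have "r \<in> desc v" using con v(1) r(1) by blast
    then show False using desc_ge[of r v] r(2)[OF v(1)] v(2) by simp
  qed
  then show "subtree S"
    unfolding subtree_def using S r by (auto intro!: bexI[of _ r] simp: le_neq_implies_less)
next
  let ?R = "(E \<union> E\<inverse>) \<inter> S \<times> S"
  assume sub: "subtree S"
  obtain r where r: "r \<in> S" "\<And>v. v \<in> S \<Longrightarrow> v \<noteq> r \<Longrightarrow> v \<in> inner S \<and> r < v"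
    using subtree_root[OF sub] by blast
  have to_root: "(v, r) \<in> ?R\<^sup>*" if "v \<in> S" for v
    using that
  proof (induction v rule: less_induct)
    case (less v)
    show ?case
    proof (cases "v = r")
      case False
      then have v: "v \<in> inner S" using r(2) less.prems by blast
      have vn: "0 < v" "v \<le> n" "par v \<in> S"
        using innerD[OF v] subtree_le[OF sub less.prems] by simp_all
      then have "(par v, v) \<in> E" using E by auto
      then have "(v, par v) \<in> ?R" using less.prems vn(3) by blast
      then show ?thesis
        using less.IH[OF par_less[OF vn(1,2)] vn(3)] by (rule converse_rtrancl_into_rtrancl)
    qed simp
  qed
  have "sym ?R" by (auto simp: sym_def)
  then have "sym (?R\<^sup>*)" by (rule sym_rtrancl)
  then have "(r, v) \<in> ?R\<^sup>*" if "v \<in> S" for v using to_root[OF that] by (rule symD)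
  then have "(u, w) \<in> ?R\<^sup>*" if "u \<in> S" "w \<in> S" for u w
    using rtrancl_trans[OF to_root[OF that(1)]] that(2) by blast
  then show ?con using r(1) by blast
qed

end

section \<open>The parent function of a plane tree\<close>

lemma append_eq_upt:
  assumes "xs @ ys = [j..<m]" "j \<le> m"
  shows "xs = [j..<j + length xs]" "ys = [j + length xs..<m]" "j + length xs \<le> m"
proof -
  have "length xs + length ys = m - j" using arg_cong[OF assms(1), of length] by simp
  then show le: "j + length xs \<le> m" using assms(2) by simp
  have "xs = take (length xs) [j..<m]" using assms(1) by (metis append_eq_conv_conj)
  then show "xs = [j..<j + length xs]" using take_upt[OF le] by simp
  have "ys = drop (length xs) [j..<m]" using assms(1) by (metis append_eq_conv_conj)
  then show "ys = [j + length xs..<m]" by simp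
qed

text \<open>\<open>E\<close> consists of the edges of a forest on \<open>{j..<m}\<close> numbered in preorder, together with the
  edges joining its roots to a further vertex \<open>k\<close>.\<close>

definition preorder_edges :: "nat \<Rightarrow> nat \<Rightarrow> nat \<Rightarrow> (nat \<times> nat) set \<Rightarrow> bool" where
  "preorder_edges k j m E \<longleftrightarrow>
     (\<forall>u v. (u, v) \<in> E \<longrightarrow> (u = k \<or> j \<le> u) \<and> u < v \<and> j \<le> v \<and> v < m) \<and>
     (\<forall>v. j \<le> v \<and> v < m \<longrightarrow> (\<exists>!u. (u, v) \<in> E)) \<and>
     (\<forall>u v u' v'. (u, v) \<in> E \<longrightarrow> (u', v') \<in> E \<longrightarrow> u < v' \<longrightarrow> v' < v \<longrightarrow> u \<le> u')"

text \<open>\<open>E\<close> is the subtree of the first child \<open>j\<close>, and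
  \<open>F\<close> holds its later siblings with their subtrees. Arcs of \<open>F\<close> starting
  at \<open>k\<close> may enclose \<open>E\<close>, but \<open>k\<close> is smaller than every other
  parent; all other arcs of \<open>E\<close> and \<open>F\<close> occupy disjoint intervals.\<close>

lemma preorder_edges_Cons:
  assumes t: "preorder_edges j (Suc j) l E" and ts: "preorder_edges k l m F"
    and "k < j" "j < l" "l \<le> m"
  shows "preorder_edges k j m (insert (k, j) (E \<union> F))"
proof -
  have E: "\<And>u v. (u, v) \<in> E \<Longrightarrow> j \<le> u \<and> u < v \<and> j < v \<and> v < l"
    and Eu: "\<And>v. j < v \<Longrightarrow> v < l \<Longrightarrow> \<exists>!u. (u, v) \<in> E"
    and Ec: "\<And>u v u' v'. (u, v) \<in> E \<Longrightarrow> (u', v') \<in> E \<Longrightarrow> u < v' \<Longrightarrow> v' < v \<Longrightarrow> u \<le> u'"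
    using t unfolding preorder_edges_def by (fastforce, force, blast)
  have F: "\<And>u v. (u, v) \<in> F \<Longrightarrow> (u = k \<or> l \<le> u) \<and> u < v \<and> l \<le> v \<and> v < m"
    and Fu: "\<And>v. l \<le> v \<Longrightarrow> v < m \<Longrightarrow> \<exists>!u. (u, v) \<in> F"
    and Fc: "\<And>u v u' v'. (u, v) \<in> F \<Longrightarrow> (u', v') \<in> F \<Longrightarrow> u < v' \<Longrightarrow> v' < v \<Longrightarrow> u \<le> u'"
    using ts unfolding preorder_edges_def by blast+
  let ?G = "insert (k, j) (E \<union> F)"
  have bounds: "(u = k \<or> j \<le> u) \<and> u < v \<and> j \<le> v \<and> v < m" if "(u, v) \<in> ?G" for u v
    using that E[of u v] F[of u v] assms(3-5) by auto
  have unique: "\<exists>!u. (u, v) \<in> ?G" if v: "j \<le> v" "v < m" for v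
  proof -
    consider "v = j" | "j < v" "v < l" | "l \<le> v" using v(1) by linarith
    then show ?thesis
    proof cases
      case 1
      then have "(u, v) \<in> ?G \<longleftrightarrow> u = k" for u using E[of u v] F[of u v] assms(4) by auto
      then show ?thesis by simp
    next
      case 2
      then have "(u, v) \<in> ?G \<longleftrightarrow> (u, v) \<in> E" for u using F[of u v] by auto
      then show ?thesis using Eu[OF 2] by simp
    next
      case 3
      then have "(u, v) \<in> ?G \<longleftrightarrow> (u, v) \<in> F" for u using E[of u v] assms(4) by auto
      then show ?thesis using Fu[OF 3 v(2)] by simp
    qed
  qed
  have "u \<le> u'" if uv: "(u, v) \<in> ?G" "(u', v') \<in> ?G" "u < v'" "v' < v" for u v u' v'
  proof (cases "u = k")
    case True
    then show ?thesis using bounds[OF uv(2)] assms(3) by auto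
  next
    case False
    then consider "(u, v) \<in> E" | "(u, v) \<in> F" using uv(1) by blast
    then show ?thesis
    proof cases
      case 1
      then have "(u', v') \<in> E" using uv(2-4) E[of u v] F[of u' v'] by auto
      then show ?thesis using Ec[OF 1] uv(3,4) by blast
    next
      case 2
      then have "(u', v') \<in> F" using uv(2-4) F[of u v] E[of u' v'] False assms(4) by auto
      then show ?thesis using Fc[OF 2] uv(3,4) by blast
    qed
  qed
  then show ?thesis
    unfolding preorder_edges_def using bounds unique by (intro conjI allI impI) simp_all
qed

text \<open>The parent \<open>k\<close> is independent of \<open>j\<close> because the induction
  over siblings advances \<open>j\<close> while the parent stays behind.\<close>

lemma preorder_edges_children:
  assumes "\<And>t j l. t \<in> set ts \<Longrightarrow> preorder_traversal t = [j..<l] \<Longrightarrow> preorder_edges j (Suc j) l (edges t)"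
    and "concat (map preorder_traversal ts) = [j..<m]" "k < j" "j \<le> m"
  shows "preorder_edges k j m ((\<lambda>t. (k, root_vertex t)) ` set ts \<union> \<Union> (set (map edges ts)))"
  using assms
proof (induction ts arbitrary: j)
  case Nil
  then have "m \<le> j" using upt_eq_Nil_conv[of j m] by auto
  then show ?case by (auto simp: preorder_edges_def)
next
  case (Cons t ts)
  let ?l = "j + length (preorder_traversal t)"
  have "preorder_traversal t @ concat (map preorder_traversal ts) = [j..<m]"
    using Cons.prems(2) by simp
  note s = append_eq_upt[OF this Cons.prems(4)]
  obtain r rs where t: "t = Node r rs" by (cases t)
  have jl: "j < ?l" using t by simp
  have "[j..<?l] = r # concat (map preorder_traversal rs)"
    by (subst s(1)[symmetric]) (simp add: t)
  then have "j = r" unfolding upt_eq_Cons_conv by blast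
  then have r: "root_vertex t = j" using t by simp
  have "preorder_edges j (Suc j) ?l (edges t)" using Cons.prems(1)[OF _ s(1)] by simp
  moreover have "preorder_edges k ?l m ((\<lambda>t. (k, root_vertex t)) ` set ts \<union> \<Union> (set (map edges ts)))"
    using Cons.IH[OF _ s(2) _ s(3)] Cons.prems(1,3) by simp
  ultimately have "preorder_edges k j m (insert (k, j) (edges t \<union>
      ((\<lambda>t. (k, root_vertex t)) ` set ts \<union> \<Union> (set (map edges ts)))))"
    using preorder_edges_Cons Cons.prems(3) jl s(3) by blast
  moreover have "insert (k, j) (edges t \<union>
      ((\<lambda>t. (k, root_vertex t)) ` set ts \<union> \<Union> (set (map edges ts)))) =
    (\<lambda>t. (k, root_vertex t)) ` set (t # ts) \<union> \<Union> (set (map edges (t # ts)))"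
    using r by auto
  ultimately show ?case by simp
qed

lemma preorder_edges_tree:
  "preorder_traversal T = [j..<l] \<Longrightarrow> preorder_edges j (Suc j) l (edges T)"
proof (induction T arbitrary: j l)
  case (Node r ts)
  have "[j..<l] = r # concat (map preorder_traversal ts)" using Node.prems by simp
  then have ne: "j < l" and r: "r = j" "concat (map preorder_traversal ts) = [Suc j..<l]"
    unfolding upt_eq_Cons_conv by auto
  show ?case
    using preorder_edges_children[OF Node.IH r(2)] ne r(1) by simp
qed

lemma preorder_parents_of_tree:
  assumes "preorder_traversal T = [0..<n + 1]"
  obtains par where "preorder_parents n par" "edges T = {(par v, v) |v. v \<in> {1..n}}"
proof -
  define par where "par v = (THE u. (u, v) \<in> edges T)" for v
  have g: "preorder_edges 0 1 (n + 1) (edges T)" using preorder_edges_tree[OF assms] by simp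
  have range: "u < v" "v \<in> {1..n}" if "(u, v) \<in> edges T" for u v
    using g that unfolding preorder_edges_def by fastforce+
  have ex1: "\<exists>!u. (u, v) \<in> edges T" if "v \<in> {1..n}" for v
    using g that unfolding preorder_edges_def by simp
  have par: "(u, v) \<in> edges T \<longleftrightarrow> u = par v" if "v \<in> {1..n}" for u v
    using theI'[OF ex1[OF that]] ex1[OF that] unfolding par_def by blast
  have edge: "(par v, v) \<in> edges T" if "v \<in> {1..n}" for v using par[OF that] by simp
  show ?thesis
  proof (rule that)
    show "preorder_parents n par"
    proof
      show less: "par v < v" if "0 < v" "v \<le> n" for v using range(1)[OF edge] that by simp
      show "par v \<le> par u" if "v \<le> n" "par v < u" "u < v" for u v
      proof -
        have "(par v, v) \<in> edges T" "(par u, u) \<in> edges T" using edge that by simp_all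
        then show ?thesis using g that(2,3) unfolding preorder_edges_def by blast
      qed
    qed
    show "edges T = {(par v, v) |v. v \<in> {1..n}}"
    proof (intro equalityI subrelI)
      fix u v assume uv: "(u, v) \<in> edges T"
      note v = range(2)[OF uv]
      have "u = par v" using par[OF v] uv by simp
      then show "(u, v) \<in> {(par v, v) |v. v \<in> {1..n}}" using v by simp
    next
      fix u v assume "(u, v) \<in> {(par v, v) |v. v \<in> {1..n}}"
      then show "(u, v) \<in> edges T" using edge by auto
    qed
  qed
qed

theorem theorem1p1:
  fixes T :: "nat plane_tree" and n :: nat
  assumes "preorder_traversal T = [0..<n + 1]"
  shows "lattice (MN T)"
proof -
  obtain par where par: "preorder_parents n par" and E: "edges T = {(par v, v) |v. v \<in> {1..n}}"
    using preorder_parents_of_tree[OF assms] .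
  interpret preorder_parents n par by (rule par)
  have V: "vertices T = {..n}" using assms by (auto simp: vertices_def)
  have tube: "tube T S \<longleftrightarrow> subtree S" for S
  proof (cases "S \<subseteq> {..n}")
    case True
    then show ?thesis
      using connected_iff_subtree[OF E] by (simp add: tube_def induces_connected_def V)
  next
    case False
    then show ?thesis by (simp add: tube_def V subtree_def)
  qed
  have carrier: "maximal_nestings T = mnest"
    by (auto simp: maximal_nestings_def nesting_def mnest_def tube V)
  have "nesting_cover T N N' \<longleftrightarrow> up_step N N'" for N N'
  proof (cases "N \<in> mnest \<and> N' \<in> mnest")
    case True
    then show ?thesis using exchange_iff_up_step[of N N'] by (simp add: nesting_cover_def carrier)
  next
    case False
    then show ?thesis using up_stepD(1)[of N N'] by (auto simp: nesting_cover_def carrier up_step_def)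
  qed
  then have "nesting_cover T = up_step" by (intro ext)
  then show ?thesis using lattice_mnest by (simp add: MN_def carrier)
qed

end
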